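(* Let $k$ be a field, $n\ge2$, and let $A=k\langle x_1,\dots,x_n\rangle/\langle x_i^2,\ x_ix_j-x_jx_i,\ 1\le i,j\le n\rangle$. Define $k$-linear maps $\varepsilon:A\to k$ and $\Delta:A\to A\otimes A$ by $$\varepsilon(x_{\mathbf v})=\delta_{\mathbf 0,\mathbf v},\qquad \Delta(x_{\mathbf v})=\sum_{\substack{\mathbf v_1,\mathbf v_2\le\mathbf v\\ \mathbf v\le\mathbf v_1+\mathbf v_2}}(-1)^{|\mathbf v_1+\mathbf v_2-\mathbf v|}\,x_{\mathbf v_1}\otimes x_{\mathbf v_2},\qquad \mathbf v\in V.$$ Then, with counit $\varepsilon$ and comultiplication $\Delta$, $(A,\ \phi,\ t=x_1\cdots x_n,\ \mathrm{Id})$ is a bi-Frobenius algebra, where $\phi=\sum_{\mathbf v\in V}(x_{\mathbf v})^*$. Moreover, this bi-Frobenius algebra has no nonzero primitive elements, and hence it is not isomorphic (as a bi-Frobenius algebra) to either of the following bi-Frobenius algebras on $A$: (a) any bi-Frobenius algebra $(A,(x_{\mathbf 1})^*,x_{\mathbf 1},S)$ with counit $\varepsilon$ and comultiplication $\Delta_g$ for an admissible family $g$; (b) the bi-Frobenius algebra $(A,(x_{\mathbf 1})^*,x_{\mathbf 1},\mathrm{Id})$ with counit $\varepsilon$ and comultiplication $x_{\mathbf v}\mapsto\sum_{\mathbf v_1,\mathbf v_2\in V,\ \mathbf v_1+\mathbf v_2=\mathbf v}x_{\mathbf v_1}\otimes x_{\mathbf v_2}$ for $\mathbf v\in V$.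
   Context: Notation. $\mathbf 0=(0,\dots,0)$, $\mathbf 1=(1,\dots,1)$, $V=\{0,1\}^n\subset\mathbb N_0^n$, $|\mathbf w|=\sum_i w_i$, $\mathbf u\le\mathbf v$ means $u_i\le v_i$ for all $i$, and $x_{\mathbf v}=x_1^{v_1}\cdots x_n^{v_n}$. $\{x_{\mathbf v}\mid\mathbf v\in V\}$ is a basis of $A$ with dual basis $\{(x_{\mathbf v})^*\}$ of $A^*=\mathrm{Hom}_k(A,k)$. An element $x$ is primitive if $\Delta(x)=1\otimes x+x\otimes 1$. Admissible families and $\Delta_g$. An admissible family $g$ consists of nonzero elements $g_{\mathbf v,\mathbf 1-\mathbf v}\in k$, $\mathbf v\in V$, with $g_{\mathbf 0,\mathbf 1}=1=g_{\mathbf 1,\mathbf 0}$. Then $\Delta_g:A\to A\otimes A$ is the linear map with $\Delta_g(1)=1\otimes1$; $\Delta_g(x_{\mathbf v})=1\otimes x_{\mathbf v}+x_{\mathbf v}\otimes1$ for $\mathbf v\in V$, $\mathbf 0\ne\mathbf v\ne\mathbf 1$; $\Delta_g(x_{\mathbf 1})=\sum_{\mathbf v\in V}g_{\mathbf v,\mathbf 1-\mathbf v}\,x_{\mathbf v}\otimes x_{\mathbf 1-\mathbf v}$. Bi-Frobenius algebras. Let $A$ be a finite-dimensional algebra that is also a coalgebra over $k$ (no compatibility assumed), $t\in A$, $\phi\in A^*$, and let $S:A\to A$ be the linear map $S(a)=\sum\phi(t_1a)t_2$, where $\Delta(t)=\sum t_1\otimes t_2$. The quadruple $(A,\phi,t,S)$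 is a bi-Frobenius algebra if: (i) $\varepsilon$ is an algebra homomorphism and $1_A$ is group-like; (ii) $(A,\phi)$ is a Frobenius algebra, i.e. $A^*=A\rightharpoonup\phi$ where $(a\rightharpoonup\phi)(x)=\phi(xa)$, and $(A,t)$ is a Frobenius coalgebra, i.e. $A=t\leftharpoonup A^*$ where $t\leftharpoonup f=\sum f(t_1)t_2$; (iii) $S$ is an algebra anti-homomorphism and a coalgebra anti-homomorphism (i.e. $\varepsilon\circ S=\varepsilon$ and $\Delta(S(a))=\sum S(a_2)\otimes S(a_1)$ for all $a\in A$). A homomorphism of bi-Frobenius algebras $F:(A,\phi,t,S)\to(A',\phi',t',S')$ is an algebra and coalgebra homomorphism with $F\circ S=S'\circ F$; an isomorphism is a bijective homomorphism. *)

theory Defs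
  imports Complex_Main "HOL-Library.Poly_Mapping" "HOL-Library.Cardinality" "HOL-Library.Function_Algebras"
begin

section \<open>Tensor products as formal sums\<close>

text \<open>
  The type \<open>'x \<Rightarrow>\<^sub>0 'k\<close> is the vector space over \<open>'k\<close> with basis \<open>'x\<close>.
  A vector space over \<open>'k\<close> is a type \<open>'a\<close> together with a scalar multiplication \<open>s\<close>.
  Since \<open>s\<close> is a term, the quotient
  \<open>A \<otimes> A = ('a \<times> 'a \<Rightarrow>\<^sub>0 'k) / (bilinear relations)\<close> cannot be turned into a type
  uniformly in \<open>s\<close>.  An element of \<open>A \<otimes> A\<close> is therefore given by a formal sum representing it,
  and equality in \<open>A \<otimes> A\<close> is \<open>tensor2_eq s\<close>, i.e. congruence modulo the span of the bilinear
  relations; likewise for \<open>A \<otimes> A \<otimes> A\<close>.  A comultiplication \<open>A \<rightarrow> A \<otimes> A\<close> is a function into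
  formal sums, and every condition imposed on it below depends only on the tensors represented.
\<close>

definition fscale :: "'k::field \<Rightarrow> ('x \<Rightarrow>\<^sub>0 'k) \<Rightarrow> ('x \<Rightarrow>\<^sub>0 'k)" where
  "fscale c = Poly_Mapping.map ((*) c)"

definition pure :: "'x \<Rightarrow> ('x \<Rightarrow>\<^sub>0 'k::field)" where
  "pure p = Poly_Mapping.single p 1"

abbreviation tensor :: "'a \<Rightarrow> 'b \<Rightarrow> ('a \<times> 'b \<Rightarrow>\<^sub>0 'k::field)" (infix \<open>\<otimes>\<close> 72) where
  "a \<otimes> b \<equiv> pure (a, b)"

text \<open>
  Linear extension of \<open>\<beta>\<close> to formal sums, with values in a space with scalar multiplication \<open>s\<close>.
  In Sweedler notation, if \<open>u\<close> represents \<open>\<Sum> u\<^sub>1 \<otimes> u\<^sub>2\<close>, then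
  \<open>extend s (\<lambda>(a, b). \<beta> a b) u\<close> is \<open>\<Sum> \<beta> u\<^sub>1 u\<^sub>2\<close>.
\<close>

definition extend ::
  "('k::field \<Rightarrow> 'b::ab_group_add \<Rightarrow> 'b) \<Rightarrow> ('x \<Rightarrow> 'b) \<Rightarrow> ('x \<Rightarrow>\<^sub>0 'k) \<Rightarrow> 'b" where
  "extend s \<beta> u = (\<Sum>p\<in>Poly_Mapping.keys u. s (Poly_Mapping.lookup u p) (\<beta> p))"

definition tensor2_null ::
  "('k::field \<Rightarrow> 'a::ab_group_add \<Rightarrow> 'a) \<Rightarrow> ('a \<times> 'a \<Rightarrow>\<^sub>0 'k) set" where
  "tensor2_null s = module.span fscale
    ({(a + a') \<otimes> b - a \<otimes> b - a' \<otimes> b | a a' b. True} \<union>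
     {a \<otimes> (b + b') - a \<otimes> b - a \<otimes> b' | a b b'. True} \<union>
     {s c a \<otimes> b - fscale c (a \<otimes> b) | c a b. True} \<union>
     {a \<otimes> s c b - fscale c (a \<otimes> b) | c a b. True})"

definition tensor2_eq ::
  "('k::field \<Rightarrow> 'a::ab_group_add \<Rightarrow> 'a) \<Rightarrow> ('a \<times> 'a \<Rightarrow>\<^sub>0 'k) \<Rightarrow> ('a \<times> 'a \<Rightarrow>\<^sub>0 'k) \<Rightarrow> bool" where
  "tensor2_eq s u v \<longleftrightarrow> u - v \<in> tensor2_null s"

definition tensor3_null ::
  "('k::field \<Rightarrow> 'a::ab_group_add \<Rightarrow> 'a) \<Rightarrow> ('a \<times> 'a \<times> 'a \<Rightarrow>\<^sub>0 'k) set" where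
  "tensor3_null s = module.span fscale
    ({pure (a + a', b, c) - pure (a, b, c) - pure (a', b, c) | a a' b c. True} \<union>
     {pure (a, b + b', c) - pure (a, b, c) - pure (a, b', c) | a b b' c. True} \<union>
     {pure (a, b, c + c') - pure (a, b, c) - pure (a, b, c') | a b c c'. True} \<union>
     {pure (s r a, b, c) - fscale r (pure (a, b, c)) | r a b c. True} \<union>
     {pure (a, s r b, c) - fscale r (pure (a, b, c)) | r a b c. True} \<union>
     {pure (a, b, s r c) - fscale r (pure (a, b, c)) | r a b c. True})"

definition tensor3_eq ::
  "('k::field \<Rightarrow> 'a::ab_group_add \<Rightarrow> 'a) \<Rightarrow> ('a \<times> 'a \<times> 'a \<Rightarrow>\<^sub>0 'k) \<Rightarrow>
   ('a \<times> 'a \<times> 'a \<Rightarrow>\<^sub>0 'k) \<Rightarrow> bool" where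
  "tensor3_eq s u v \<longleftrightarrow> u - v \<in> tensor3_null s"


section \<open>Algebras, coalgebras and bi-Frobenius algebras\<close>

locale fin_dim_algebra = vector_space s
  for s :: "'k::field \<Rightarrow> 'a::ring_1 \<Rightarrow> 'a" +
  assumes scale_mult_left: "s c (a * b) = s c a * b"
    and scale_mult_right: "s c (a * b) = a * s c b"
    and finite_spanning: "\<exists>B. finite B \<and> span B = UNIV"

locale coalgebra = vector_space s
  for s :: "'k::field \<Rightarrow> 'a::ab_group_add \<Rightarrow> 'a"
    and \<epsilon> :: "'a \<Rightarrow> 'k"
    and \<Delta> :: "'a \<Rightarrow> ('a \<times> 'a \<Rightarrow>\<^sub>0 'k)" +
  assumes counit_linear: "Vector_Spaces.linear s (*) \<epsilon>"
    and comult_add: "tensor2_eq s (\<Delta> (a + b)) (\<Delta> a + \<Delta> b)"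
    and comult_scale: "tensor2_eq s (\<Delta> (s c a)) (fscale c (\<Delta> a))"
    and counit_left: "extend s (\<lambda>(a\<^sub>1, a\<^sub>2). s (\<epsilon> a\<^sub>1) a\<^sub>2) (\<Delta> a) = a"
    and counit_right: "extend s (\<lambda>(a\<^sub>1, a\<^sub>2). s (\<epsilon> a\<^sub>2) a\<^sub>1) (\<Delta> a) = a"
    and coassociative:
      "tensor3_eq s
        (extend fscale (\<lambda>(a\<^sub>1, a\<^sub>2). extend fscale (\<lambda>(b\<^sub>1, b\<^sub>2). pure (b\<^sub>1, b\<^sub>2, a\<^sub>2)) (\<Delta> a\<^sub>1)) (\<Delta> a))
        (extend fscale (\<lambda>(a\<^sub>1, a\<^sub>2). extend fscale (\<lambda>(b\<^sub>1, b\<^sub>2). pure (a\<^sub>1, b\<^sub>1, b\<^sub>2)) (\<Delta> a\<^sub>2)) (\<Delta> a))"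

definition algebra_hom ::
  "('k::field \<Rightarrow> 'a::ring_1 \<Rightarrow> 'a) \<Rightarrow> ('k \<Rightarrow> 'b::ring_1 \<Rightarrow> 'b) \<Rightarrow> ('a \<Rightarrow> 'b) \<Rightarrow> bool" where
  "algebra_hom s s' F \<longleftrightarrow>
     Vector_Spaces.linear s s' F \<and> F 1 = 1 \<and> (\<forall>a b. F (a * b) = F a * F b)"

definition algebra_antihom ::
  "('k::field \<Rightarrow> 'a::ring_1 \<Rightarrow> 'a) \<Rightarrow> ('k \<Rightarrow> 'b::ring_1 \<Rightarrow> 'b) \<Rightarrow> ('a \<Rightarrow> 'b) \<Rightarrow> bool" where
  "algebra_antihom s s' F \<longleftrightarrow>
     Vector_Spaces.linear s s' F \<and> F 1 = 1 \<and> (\<forall>a b. F (a * b) = F b * F a)"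

definition coalgebra_hom ::
  "('k::field \<Rightarrow> 'a::ab_group_add \<Rightarrow> 'a) \<Rightarrow> ('a \<Rightarrow> 'k) \<Rightarrow> ('a \<Rightarrow> ('a \<times> 'a \<Rightarrow>\<^sub>0 'k)) \<Rightarrow>
   ('k \<Rightarrow> 'b::ab_group_add \<Rightarrow> 'b) \<Rightarrow> ('b \<Rightarrow> 'k) \<Rightarrow> ('b \<Rightarrow> ('b \<times> 'b \<Rightarrow>\<^sub>0 'k)) \<Rightarrow> ('a \<Rightarrow> 'b) \<Rightarrow> bool" where
  "coalgebra_hom s \<epsilon> \<Delta> s' \<epsilon>' \<Delta>' F \<longleftrightarrow>
     Vector_Spaces.linear s s' F \<and>
     (\<forall>a. \<epsilon>' (F a) = \<epsilon> a) \<and>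
     (\<forall>a. tensor2_eq s' (\<Delta>' (F a)) (extend fscale (\<lambda>(a\<^sub>1, a\<^sub>2). F a\<^sub>1 \<otimes> F a\<^sub>2) (\<Delta> a)))"

definition coalgebra_antihom ::
  "('k::field \<Rightarrow> 'a::ab_group_add \<Rightarrow> 'a) \<Rightarrow> ('a \<Rightarrow> 'k) \<Rightarrow> ('a \<Rightarrow> ('a \<times> 'a \<Rightarrow>\<^sub>0 'k)) \<Rightarrow>
   ('k \<Rightarrow> 'b::ab_group_add \<Rightarrow> 'b) \<Rightarrow> ('b \<Rightarrow> 'k) \<Rightarrow> ('b \<Rightarrow> ('b \<times> 'b \<Rightarrow>\<^sub>0 'k)) \<Rightarrow> ('a \<Rightarrow> 'b) \<Rightarrow> bool" where
  "coalgebra_antihom s \<epsilon> \<Delta> s' \<epsilon>' \<Delta>' F \<longleftrightarrow>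
     Vector_Spaces.linear s s' F \<and>
     (\<forall>a. \<epsilon>' (F a) = \<epsilon> a) \<and>
     (\<forall>a. tensor2_eq s' (\<Delta>' (F a)) (extend fscale (\<lambda>(a\<^sub>1, a\<^sub>2). F a\<^sub>2 \<otimes> F a\<^sub>1) (\<Delta> a)))"

definition grouplike ::
  "('k::field \<Rightarrow> 'a::ab_group_add \<Rightarrow> 'a) \<Rightarrow> ('a \<Rightarrow> 'k) \<Rightarrow> ('a \<Rightarrow> ('a \<times> 'a \<Rightarrow>\<^sub>0 'k)) \<Rightarrow> 'a \<Rightarrow> bool" where
  "grouplike s \<epsilon> \<Delta> x \<longleftrightarrow> tensor2_eq s (\<Delta> x) (x \<otimes> x) \<and> \<epsilon> x = 1"

definition primitive ::
  "('k::field \<Rightarrow> 'a::ring_1 \<Rightarrow> 'a) \<Rightarrow> ('a \<Rightarrow> ('a \<times> 'a \<Rightarrow>\<^sub>0 'k)) \<Rightarrow> 'a \<Rightarrow> bool" where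
  "primitive s \<Delta> x \<longleftrightarrow> tensor2_eq s (\<Delta> x) (1 \<otimes> x + x \<otimes> 1)"

definition dual_space :: "('k::field \<Rightarrow> 'a::ab_group_add \<Rightarrow> 'a) \<Rightarrow> ('a \<Rightarrow> 'k) set" where
  "dual_space s = {f. Vector_Spaces.linear s (*) f}"

definition frobenius_algebra :: "('k::field \<Rightarrow> 'a::ring_1 \<Rightarrow> 'a) \<Rightarrow> ('a \<Rightarrow> 'k) \<Rightarrow> bool" where
  "frobenius_algebra s \<phi> \<longleftrightarrow>
     \<phi> \<in> dual_space s \<and> dual_space s = range (\<lambda>a x. \<phi> (x * a))"

definition frobenius_coalgebra ::
  "('k::field \<Rightarrow> 'a::ab_group_add \<Rightarrow> 'a) \<Rightarrow> ('a \<Rightarrow> ('a \<times> 'a \<Rightarrow>\<^sub>0 'k)) \<Rightarrow> 'a \<Rightarrow> bool" where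
  "frobenius_coalgebra s \<Delta> t \<longleftrightarrow>
     UNIV = (\<lambda>f. extend s (\<lambda>(t\<^sub>1, t\<^sub>2). s (f t\<^sub>1) t\<^sub>2) (\<Delta> t)) ` dual_space s"

locale bi_frobenius =
  fin_dim_algebra s + coalgebra s \<epsilon> \<Delta>
  for s :: "'k::field \<Rightarrow> 'a::ring_1 \<Rightarrow> 'a"
    and \<epsilon> :: "'a \<Rightarrow> 'k"
    and \<Delta> :: "'a \<Rightarrow> ('a \<times> 'a \<Rightarrow>\<^sub>0 'k)"
    and \<phi> :: "'a \<Rightarrow> 'k"
    and t :: 'a
    and S :: "'a \<Rightarrow> 'a" +
  assumes antipode_eq: "S a = extend s (\<lambda>(t\<^sub>1, t\<^sub>2). s (\<phi> (t\<^sub>1 * a)) t\<^sub>2) (\<Delta> t)"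
    and counit_hom: "algebra_hom s (*) \<epsilon>"
    and one_grouplike: "grouplike s \<epsilon> \<Delta> 1"
    and frobenius_alg: "frobenius_algebra s \<phi>"
    and frobenius_coalg: "frobenius_coalgebra s \<Delta> t"
    and antipode_algebra_antihom: "algebra_antihom s s S"
    and antipode_coalgebra_antihom: "coalgebra_antihom s \<epsilon> \<Delta> s \<epsilon> \<Delta> S"

text \<open>
  Homomorphisms are not required to respect \<open>\<phi>\<close> and \<open>t\<close>, only the algebra, the coalgebra
  and \<open>S\<close>.
\<close>

definition bi_frobenius_hom ::
  "('k::field \<Rightarrow> 'a::ring_1 \<Rightarrow> 'a) \<Rightarrow> ('a \<Rightarrow> 'k) \<Rightarrow> ('a \<Rightarrow> ('a \<times> 'a \<Rightarrow>\<^sub>0 'k)) \<Rightarrow> ('a \<Rightarrow> 'a) \<Rightarrow>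
   ('k \<Rightarrow> 'b::ring_1 \<Rightarrow> 'b) \<Rightarrow> ('b \<Rightarrow> 'k) \<Rightarrow> ('b \<Rightarrow> ('b \<times> 'b \<Rightarrow>\<^sub>0 'k)) \<Rightarrow> ('b \<Rightarrow> 'b) \<Rightarrow>
   ('a \<Rightarrow> 'b) \<Rightarrow> bool" where
  "bi_frobenius_hom s \<epsilon> \<Delta> S s' \<epsilon>' \<Delta>' S' F \<longleftrightarrow>
     algebra_hom s s' F \<and> coalgebra_hom s \<epsilon> \<Delta> s' \<epsilon>' \<Delta>' F \<and> F \<circ> S = S' \<circ> F"

definition bi_frobenius_isomorphic ::
  "('k::field \<Rightarrow> 'a::ring_1 \<Rightarrow> 'a) \<Rightarrow> ('a \<Rightarrow> 'k) \<Rightarrow> ('a \<Rightarrow> ('a \<times> 'a \<Rightarrow>\<^sub>0 'k)) \<Rightarrow> ('a \<Rightarrow> 'a) \<Rightarrow>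
   ('k \<Rightarrow> 'b::ring_1 \<Rightarrow> 'b) \<Rightarrow> ('b \<Rightarrow> 'k) \<Rightarrow> ('b \<Rightarrow> ('b \<times> 'b \<Rightarrow>\<^sub>0 'k)) \<Rightarrow> ('b \<Rightarrow> 'b) \<Rightarrow> bool" where
  "bi_frobenius_isomorphic s \<epsilon> \<Delta> S s' \<epsilon>' \<Delta>' S' \<longleftrightarrow>
     (\<exists>F. bij F \<and> bi_frobenius_hom s \<epsilon> \<Delta> S s' \<epsilon>' \<Delta>' S' F)"


section \<open>The algebra \<open>A\<close>\<close>

subsection \<open>Free algebra and relations\<close>

text \<open>
  The variables are indexed by the type \<open>'n\<close> (finite, with \<open>CARD('n) = n\<close>, from the definition
  of the basis on).  The free algebra \<open>k\<langle>x\<^sub>i\<rangle>\<close> is the monoid algebra of the free monoid on \<open>'n\<close>,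
  i.e. \<open>'n free_monoid \<Rightarrow>\<^sub>0 'k\<close> with the convolution product of \<^theory>\<open>HOL-Library.Poly_Mapping\<close>.
\<close>

datatype 'n free_monoid = Word "'n list"

instantiation free_monoid :: (type) monoid_add
begin
definition zero_free_monoid :: "'a free_monoid" where "0 = Word []"
fun plus_free_monoid :: "'a free_monoid \<Rightarrow> 'a free_monoid \<Rightarrow> 'a free_monoid" where
  "Word u + Word v = Word (u @ v)"
instance
proof
  fix a b c :: "'a free_monoid"
  show "a + b + c = a + (b + c)" by (cases a; cases b; cases c) simp
  show "0 + a = a" "a + 0 = a" by (cases a; simp add: zero_free_monoid_def)+
qed
end

type_synonym ('n, 'k) free_algebra = "'n free_monoid \<Rightarrow>\<^sub>0 'k"

definition xfree :: "'n \<Rightarrow> ('n, 'k::field) free_algebra" where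
  "xfree i = Poly_Mapping.single (Word [i]) 1"

inductive_set two_sided_ideal :: "'r::ring_1 set \<Rightarrow> 'r set" for R where
  zero: "0 \<in> two_sided_ideal R"
| gen: "r \<in> R \<Longrightarrow> a * r * b \<in> two_sided_ideal R"
| add: "p \<in> two_sided_ideal R \<Longrightarrow> q \<in> two_sided_ideal R \<Longrightarrow> p + q \<in> two_sided_ideal R"

definition relations :: "('n, 'k::field) free_algebra set" where
  "relations = {xfree i ^ 2 | i. True} \<union> {xfree i * xfree j - xfree j * xfree i | i j. True}"

lemma two_sided_ideal_mult:
  assumes "p \<in> two_sided_ideal R"
  shows "a * p \<in> two_sided_ideal R" "p * b \<in> two_sided_ideal R"
  using assms
proof induction
  case (gen r a' b')
  { case 1 show ?case using two_sided_ideal.gen[OF gen, of "a * a'" b'] by (simp add: mult.assoc) }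
  { case 2 show ?case using two_sided_ideal.gen[OF gen, of a' "b' * b"] by (simp add: mult.assoc) }
qed (auto simp: distrib_left distrib_right intro: two_sided_ideal.intros)

lemma two_sided_ideal_minus:
  assumes "p \<in> two_sided_ideal R"
  shows "- p \<in> two_sided_ideal R"
  using two_sided_ideal_mult(1)[OF assms, of "- 1"] by simp

lemma two_sided_ideal_diff:
  "p \<in> two_sided_ideal R \<Longrightarrow> q \<in> two_sided_ideal R \<Longrightarrow> p - q \<in> two_sided_ideal R"
  using two_sided_ideal.add[of p R "- q"] two_sided_ideal_minus[of q R] by simp

lemma fscale_eq_mult:
  fixes u :: "('n, 'k::field) free_algebra"
  shows "fscale c u = Poly_Mapping.single 0 c * u"
proof (rule poly_mapping_eqI)
  fix w
  have "Sum_any (\<lambda>l :: 'n free_monoid. (c when 0 = l) * Sum_any (\<lambda>q. Poly_Mapping.lookup u q when w = l + q)) =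
        Sum_any (\<lambda>l :: 'n free_monoid. (c * Poly_Mapping.lookup u w) when 0 = l)"
  proof (rule Sum_any.cong)
    fix l :: "'n free_monoid"
    show "(c when 0 = l) * Sum_any (\<lambda>q. Poly_Mapping.lookup u q when w = l + q) =
          ((c * Poly_Mapping.lookup u w) when 0 = l)"
      by (cases "l = 0") simp_all
  qed
  then show "Poly_Mapping.lookup (fscale c u) w = Poly_Mapping.lookup (Poly_Mapping.single 0 c * u) w"
    by (simp add: fscale_def Poly_Mapping.map.rep_eq lookup_mult lookup_single when_def)
qed

lemma lookup_mult_zero:
  fixes p q :: "('n, 'k::field) free_algebra"
  shows "Poly_Mapping.lookup (p * q) 0 = Poly_Mapping.lookup p 0 * Poly_Mapping.lookup q 0"
proof -
  have *: "0 = l + m \<longleftrightarrow> l = 0 \<and> m = 0" for l m :: "'n free_monoid"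
    by (cases l; cases m) (auto simp: zero_free_monoid_def)
  have "Sum_any (\<lambda>m :: 'n free_monoid. Poly_Mapping.lookup q m when 0 = l + m) = (Poly_Mapping.lookup q 0 when l = 0)"
    for l :: "'n free_monoid"
  proof -
    have "Sum_any (\<lambda>m :: 'n free_monoid. Poly_Mapping.lookup q m when 0 = l + m) =
          Sum_any (\<lambda>m :: 'n free_monoid. (Poly_Mapping.lookup q 0 when l = 0) when m = 0)"
      by (rule Sum_any.cong) (auto simp: * when_def)
    then show ?thesis by simp
  qed
  then have "Poly_Mapping.lookup (p * q) 0 =
      Sum_any (\<lambda>l :: 'n free_monoid. Poly_Mapping.lookup p l * (Poly_Mapping.lookup q 0 when l = 0))"
    by (simp add: lookup_mult)
  also have "\<dots> = Sum_any (\<lambda>l :: 'n free_monoid. (Poly_Mapping.lookup p 0 * Poly_Mapping.lookup q 0) when l = 0)"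
    by (rule Sum_any.cong) (auto simp: when_def)
  finally show ?thesis by simp
qed

lemma free_algebra_induct [case_names const var add mult]:
  fixes p :: "('n, 'k::field) free_algebra"
  assumes const: "\<And>c. P (Poly_Mapping.single 0 c)"
    and var: "\<And>i. P (xfree i)"
    and add: "\<And>p q. P p \<Longrightarrow> P q \<Longrightarrow> P (p + q)"
    and mult: "\<And>p q. P p \<Longrightarrow> P q \<Longrightarrow> P (p * q)"
  shows "P p"
proof -
  have single: "P (Poly_Mapping.single (Word w) c)" for w c
  proof (induction w)
    case Nil
    show ?case using const[of c] by (simp add: zero_free_monoid_def)
  next
    case (Cons i w)
    have "Poly_Mapping.single (Word (i # w)) c = xfree i * Poly_Mapping.single (Word w) c"
      by (simp add: xfree_def mult_single)
    then show ?case using var mult Cons by simp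
  qed
  show ?thesis
  proof (induction p rule: update_induct)
    case const
    show ?case using assms(1)[of 0] by simp
  next
    case (update f a b)
    have "Poly_Mapping.update a b f = f + Poly_Mapping.single a b"
      using update(1) by (intro poly_mapping_eqI)
        (auto simp: lookup_update lookup_add lookup_single when_def in_keys_iff)
    then show ?case using add update single by (cases a) simp
  qed
qed

lemma commutator_in_ideal:
  fixes p q :: "('n, 'k::field) free_algebra"
  shows "p * q - q * p \<in> two_sided_ideal relations"
proof -
  let ?I = "two_sided_ideal relations :: ('n, 'k) free_algebra set"
  have central: "Poly_Mapping.single 0 c * u = u * Poly_Mapping.single 0 c"
    for c and u :: "('n, 'k) free_algebra"
    by (induction u rule: free_algebra_induct)
      (auto simp: mult_single xfree_def mult.commute algebra_simps, metis mult.assoc)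
  have closed_add: "p * (u + v) - (u + v) * p \<in> ?I"
    if "p * u - u * p \<in> ?I" "p * v - v * p \<in> ?I" for p u v
    using two_sided_ideal.add[OF that] by (simp add: algebra_simps)
  have closed_mult: "p * (u * v) - (u * v) * p \<in> ?I"
    if "p * u - u * p \<in> ?I" "p * v - v * p \<in> ?I" for p u v
    using two_sided_ideal.add[OF two_sided_ideal_mult(2)[OF that(1), of v]
        two_sided_ideal_mult(1)[OF that(2), of u]]
    by (simp add: algebra_simps)
  have flip: "u * v - v * u \<in> ?I" if "v * u - u * v \<in> ?I" for u v
    using two_sided_ideal_minus[OF that] by simp
  have var: "xfree i * q - q * xfree i \<in> ?I" for i q
  proof (induction q rule: free_algebra_induct)
    case (const c)
    show ?case by (simp add: central two_sided_ideal.zero)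
  next
    case (var j)
    have "xfree i * xfree j - xfree j * xfree i \<in> (relations :: ('n, 'k) free_algebra set)"
      by (auto simp: relations_def)
    from two_sided_ideal.gen[OF this, of 1 1] show ?case by simp
  qed (auto intro: closed_add closed_mult)
  have "q * p - p * q \<in> ?I"
  proof (induction p rule: free_algebra_induct)
    case (const c)
    show ?case by (simp add: central two_sided_ideal.zero)
  next
    case (var i)
    show ?case by (rule flip) (rule \<open>\<And>q i. xfree i * q - q * xfree i \<in> ?I\<close>)
  qed (auto intro: closed_add closed_mult)
  then show ?thesis by (rule flip)
qed


subsection \<open>The quotient\<close>

definition cong_relations :: "('n, 'k::field) free_algebra \<Rightarrow> ('n, 'k) free_algebra \<Rightarrow> bool" where
  "cong_relations p q \<longleftrightarrow> p - q \<in> two_sided_ideal relations"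

lemma equivp_cong_relations: "equivp cong_relations"
proof (rule equivpI)
  show "reflp cong_relations"
    by (auto simp: reflp_def cong_relations_def intro: two_sided_ideal.zero)
  show "symp cong_relations"
    using two_sided_ideal_minus by (fastforce simp: symp_def cong_relations_def)
  show "transp cong_relations"
    using two_sided_ideal.add by (fastforce simp: transp_def cong_relations_def)
qed

quotient_type (overloaded) ('n, 'k) algA = "('n, 'k::field) free_algebra" / cong_relations
  by (rule equivp_cong_relations)

text \<open>The relations have no constant term, so \<open>A\<close> is not the zero ring.\<close>

lemma two_sided_ideal_relations_lookup_zero:
  fixes p :: "('n, 'k::field) free_algebra"
  assumes "p \<in> two_sided_ideal relations"
  shows "Poly_Mapping.lookup p 0 = 0"
  using assms
proof induction
  case (gen r a b)
  have "Poly_Mapping.lookup (xfree i :: ('n, 'k) free_algebra) 0 = 0" for i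
    by (simp add: xfree_def lookup_single zero_free_monoid_def)
  with gen have "Poly_Mapping.lookup r 0 = 0"
    by (auto simp: relations_def lookup_minus lookup_mult_zero power2_eq_square)
  then show ?case by (simp add: lookup_mult_zero)
qed (auto simp: lookup_add)

instantiation algA :: (type, field) comm_ring_1
begin

lift_definition zero_algA :: "('a, 'b) algA" is 0 .

lift_definition one_algA :: "('a, 'b) algA" is 1 .

lift_definition plus_algA :: "('a, 'b) algA \<Rightarrow> ('a, 'b) algA \<Rightarrow> ('a, 'b) algA" is "(+)"
proof -
  fix p p' q q' :: "('a, 'b) free_algebra"
  assume "cong_relations p p'" "cong_relations q q'"
  then have "(p - p') + (q - q') \<in> two_sided_ideal relations"
    unfolding cong_relations_def by (rule two_sided_ideal.add)
  then show "cong_relations (p + q) (p' + q')"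
    by (simp add: cong_relations_def algebra_simps)
qed

lift_definition uminus_algA :: "('a, 'b) algA \<Rightarrow> ('a, 'b) algA" is uminus
proof -
  fix p p' :: "('a, 'b) free_algebra"
  assume "cong_relations p p'"
  then have "- (p - p') \<in> two_sided_ideal relations"
    unfolding cong_relations_def by (rule two_sided_ideal_minus)
  then show "cong_relations (- p) (- p')"
    by (simp add: cong_relations_def)
qed

lift_definition minus_algA :: "('a, 'b) algA \<Rightarrow> ('a, 'b) algA \<Rightarrow> ('a, 'b) algA" is "(-)"
proof -
  fix p p' q q' :: "('a, 'b) free_algebra"
  assume "cong_relations p p'" "cong_relations q q'"
  then have "(p - p') - (q - q') \<in> two_sided_ideal relations"
    unfolding cong_relations_def by (rule two_sided_ideal_diff)
  then show "cong_relations (p - q) (p' - q')"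
    by (simp add: cong_relations_def algebra_simps)
qed

lift_definition times_algA :: "('a, 'b) algA \<Rightarrow> ('a, 'b) algA \<Rightarrow> ('a, 'b) algA" is "(*)"
proof -
  fix p p' q q' :: "('a, 'b) free_algebra"
  assume "cong_relations p p'" "cong_relations q q'"
  then have "(p - p') * q + p' * (q - q') \<in> two_sided_ideal relations"
    unfolding cong_relations_def by (intro two_sided_ideal.add two_sided_ideal_mult)
  then show "cong_relations (p * q) (p' * q')"
    by (simp add: cong_relations_def algebra_simps)
qed

instance
proof
  fix a b c :: "('a, 'b) algA"
  have refl: "cong_relations p p" for p :: "('a, 'b) free_algebra"
    using equivp_cong_relations by (rule equivp_reflp)
  show "a + b + c = a + (b + c)" by transfer (simp add: add.assoc refl)
  show "a + b = b + a" by transfer (simp add: add.commute refl)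
  show "0 + a = a" by transfer (simp add: refl)
  show "- a + a = 0" by transfer (simp add: refl)
  show "a - b = a + - b" by transfer (simp add: refl)
  show "a * b * c = a * (b * c)" by transfer (simp add: mult.assoc refl)
  show "a * b = b * a" by transfer (simp add: cong_relations_def commutator_in_ideal)
  show "1 * a = a" by transfer (simp add: refl)
  show "(a + b) * c = a * c + b * c" by transfer (simp add: distrib_right refl)
  show "(0 :: ('a, 'b) algA) \<noteq> 1"
    by transfer
      (auto simp: cong_relations_def lookup_minus dest: two_sided_ideal_relations_lookup_zero)
qed

end

lift_definition scaleA :: "'k::field \<Rightarrow> ('n, 'k) algA \<Rightarrow> ('n, 'k) algA" is fscale
  unfolding cong_relations_def fscale_eq_mult right_diff_distrib[symmetric]
  by (rule two_sided_ideal_mult)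

lift_definition xvar :: "'n \<Rightarrow> ('n, 'k::field) algA" is xfree .


subsection \<open>The monomial basis\<close>

text \<open>
  Exponent vectors are functions \<open>'n \<Rightarrow> nat\<close>, with the pointwise operations and order
  (so \<open>0\<close> and \<open>1\<close> are the vectors \<open>(0,\<dots>,0)\<close> and \<open>(1,\<dots>,1)\<close>).
\<close>

definition cube :: "('n::finite \<Rightarrow> nat) set" where
  "cube = {v. \<forall>i. v i \<in> {0, 1}}"

definition weight :: "('n::finite \<Rightarrow> nat) \<Rightarrow> nat" where
  "weight w = (\<Sum>i\<in>UNIV. w i)"

definition xmon :: "('n::finite \<Rightarrow> nat) \<Rightarrow> ('n, 'k::field) algA" where
  "xmon v = (\<Prod>i\<in>UNIV. xvar i ^ v i)"

text \<open>The dual basis element \<open>(x\<^sub>v)\<^sup>*\<close>: the coordinate at \<open>x\<^sub>v\<close> with respect to the monomial basis.\<close>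

definition xdual :: "('n::finite \<Rightarrow> nat) \<Rightarrow> ('n, 'k::field) algA \<Rightarrow> 'k" where
  "xdual v a = module.representation scaleA (xmon ` cube) a (xmon v)"

text \<open>The linear map \<open>x\<^sub>v \<mapsto> F v\<close>, \<open>v \<in> cube\<close>, into a space with scalar multiplication \<open>s\<close>.\<close>

definition linear_from_basis ::
  "('k::field \<Rightarrow> 'b::ab_group_add \<Rightarrow> 'b) \<Rightarrow> (('n::finite \<Rightarrow> nat) \<Rightarrow> 'b) \<Rightarrow> ('n, 'k) algA \<Rightarrow> 'b" where
  "linear_from_basis s F a = (\<Sum>v\<in>cube. s (xdual v a) (F v))"


section \<open>The structures on \<open>A\<close>\<close>

definition epsA :: "('n::finite, 'k::field) algA \<Rightarrow> 'k" where
  "epsA = linear_from_basis (*) (\<lambda>v. if v = 0 then 1 else 0)"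

definition DeltaA ::
  "('n::finite, 'k::field) algA \<Rightarrow> (('n, 'k) algA \<times> ('n, 'k) algA \<Rightarrow>\<^sub>0 'k)" where
  "DeltaA = linear_from_basis fscale
    (\<lambda>v. \<Sum>(v\<^sub>1, v\<^sub>2)\<in>{(v\<^sub>1, v\<^sub>2)\<in>cube \<times> cube. v\<^sub>1 \<le> v \<and> v\<^sub>2 \<le> v \<and> v \<le> v\<^sub>1 + v\<^sub>2}.
          fscale ((- 1) ^ weight (v\<^sub>1 + v\<^sub>2 - v)) (xmon v\<^sub>1 \<otimes> xmon v\<^sub>2))"

definition phiA :: "('n::finite, 'k::field) algA \<Rightarrow> 'k" where
  "phiA = (\<lambda>a. \<Sum>v\<in>cube. xdual v a)"

text \<open>
  A family \<open>g\<close> is indexed by pairs; only its values \<open>g v (1 - v)\<close> at complementary pairs are used.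
\<close>

definition admissible :: "(('n::finite \<Rightarrow> nat) \<Rightarrow> ('n \<Rightarrow> nat) \<Rightarrow> 'k::field) \<Rightarrow> bool" where
  "admissible g \<longleftrightarrow> (\<forall>v\<in>cube. g v (1 - v) \<noteq> 0) \<and> g 0 1 = 1 \<and> g 1 0 = 1"

definition Delta_g ::
  "(('n::finite \<Rightarrow> nat) \<Rightarrow> ('n \<Rightarrow> nat) \<Rightarrow> 'k::field) \<Rightarrow>
   ('n, 'k) algA \<Rightarrow> (('n, 'k) algA \<times> ('n, 'k) algA \<Rightarrow>\<^sub>0 'k)" where
  "Delta_g g = linear_from_basis fscale
    (\<lambda>v. if v = 0 then 1 \<otimes> 1
         else if v = 1 then \<Sum>w\<in>cube. fscale (g w (1 - w)) (xmon w \<otimes> xmon (1 - w))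
         else 1 \<otimes> xmon v + xmon v \<otimes> 1)"

definition Delta_div ::
  "('n::finite, 'k::field) algA \<Rightarrow> (('n, 'k) algA \<times> ('n, 'k) algA \<Rightarrow>\<^sub>0 'k)" where
  "Delta_div = linear_from_basis fscale
    (\<lambda>v. \<Sum>(v\<^sub>1, v\<^sub>2)\<in>{(v\<^sub>1, v\<^sub>2)\<in>cube \<times> cube. v\<^sub>1 + v\<^sub>2 = v}. xmon v\<^sub>1 \<otimes> xmon v\<^sub>2)"

end

theory Submission
  imports Defs "HOL-Library.Multiset" "HOL-Library.FuncSet"
begin

text \<open>
  Both comultiplications with trivial antipode are \<open>n\<close>-fold tensor powers of a comultiplication on
  \<open>k[x]/(x\<^sup>2)\<close>: their structure constants on the monomial basis are products over the \<open>n\<close>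
  coordinates, and so are the values of \<open>\<phi>\<close>. Sums over the cube of such products factor, which
  reduces coassociativity, counit and antipode formula to identities for exponents in \<open>{0, 1}\<close>.
  Equality of tensors is tested on coordinates in the monomial basis.
  An isomorphism maps primitive elements to primitive elements, and for \<open>n \<ge> 2\<close> the variables
  are primitive for \<open>\<Delta>\<^sub>g\<close> and for the divided power comultiplication.
\<close>

section \<open>Formal sums and tensors\<close>

lemma lookup_fscale [simp]: "Poly_Mapping.lookup (fscale c u) p = c * Poly_Mapping.lookup u p"
  by (simp add: fscale_def Poly_Mapping.map.rep_eq when_def)

lemma keys_fscale: "Poly_Mapping.keys (fscale c u) \<subseteq> Poly_Mapping.keys u"
  by (auto simp: in_keys_iff)

lemma keys_pure [simp]: "Poly_Mapping.keys (pure p :: 'x \<Rightarrow>\<^sub>0 'k::field) = {p}"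
  by (simp add: pure_def)

lemma lookup_pure_self [simp]: "Poly_Mapping.lookup (pure p) p = 1"
  by (simp add: pure_def)

interpretation fscale: vector_space "fscale :: 'k::field \<Rightarrow> ('x \<Rightarrow>\<^sub>0 'k) \<Rightarrow> _"
  by unfold_locales (auto intro!: poly_mapping_eqI simp: lookup_add algebra_simps)

interpretation field_mult: vector_space "(*) :: 'k::field \<Rightarrow> 'k \<Rightarrow> 'k"
  by unfold_locales (auto simp: algebra_simps)

text \<open>For the field acting on itself this rule reads \<open>a * (b * c) = a * b * c\<close>,
  which would loop with \<open>mult.assoc\<close>.\<close>

declare field_mult.scale_scale [simp del]

lemma single_eq_fscale_pure: "Poly_Mapping.single p c = fscale c (pure p)"
  by (rule poly_mapping_eqI) (simp add: pure_def lookup_single when_def)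

lemma formal_sum_induct [case_names zero add scale_pure]:
  fixes u :: "'x \<Rightarrow>\<^sub>0 'k::field"
  assumes "P 0" "\<And>u v. P u \<Longrightarrow> P v \<Longrightarrow> P (u + v)" "\<And>c p. P (fscale c (pure p))"
  shows "P u"
proof (induction u rule: update_induct)
  case (update f a b)
  have "Poly_Mapping.update a b f = f + Poly_Mapping.single a b"
    using update(1) by (intro poly_mapping_eqI)
      (auto simp: lookup_update lookup_add lookup_single when_def in_keys_iff)
  then show ?case using assms update(3) by (simp add: single_eq_fscale_pure)
qed (rule assms(1))

section \<open>Linear extension of maps to formal sums\<close>

context vector_space
begin

text \<open>Terms off the support vanish. Additivity of \<open>extend\<close> needs a common index
  set because cancellation can shrink the support of a sum.\<close>

lemma extend_superset:
  assumes "finite K" "Poly_Mapping.keys u \<subseteq> K"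
  shows "extend scale \<beta> u = (\<Sum>p\<in>K. scale (Poly_Mapping.lookup u p) (\<beta> p))"
  unfolding extend_def using assms by (intro sum.mono_neutral_left) (auto simp: in_keys_iff)

lemma extend_pure [simp]: "extend scale \<beta> (pure p) = \<beta> p"
  by (simp add: extend_def)

lemma linear_extend: "Vector_Spaces.linear fscale scale (extend scale \<beta>)"
proof (unfold_locales, goal_cases)
  case (1 u v)
  have "extend scale \<beta> w = (\<Sum>p\<in>Poly_Mapping.keys u \<union> Poly_Mapping.keys v.
      scale (Poly_Mapping.lookup w p) (\<beta> p))" if "w \<in> {u, v, u + v}" for w
    using that Poly_Mapping.keys_add[of u v] by (intro extend_superset) auto
  then show ?case by (simp add: lookup_add scale_left_distrib sum.distrib)
next
  case (2 c u)
  show ?case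
    by (subst extend_superset[OF _ keys_fscale]) (simp_all add: extend_def scale_sum_right)
qed

lemma
  shows extend_zero [simp]: "extend scale \<beta> 0 = 0"
    and extend_add: "extend scale \<beta> (u + v) = extend scale \<beta> u + extend scale \<beta> v"
    and extend_diff: "extend scale \<beta> (u - v) = extend scale \<beta> u - extend scale \<beta> v"
    and extend_fscale: "extend scale \<beta> (fscale c u) = scale c (extend scale \<beta> u)"
    and extend_sum: "extend scale \<beta> (sum h I) = (\<Sum>i\<in>I. extend scale \<beta> (h i))"
proof -
  interpret l: Vector_Spaces.linear fscale scale "extend scale \<beta>" by (rule linear_extend)
  show "extend scale \<beta> 0 = 0"
    "extend scale \<beta> (u + v) = extend scale \<beta> u + extend scale \<beta> v"
    "extend scale \<beta> (u - v) = extend scale \<beta> u - extend scale \<beta> v"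
    "extend scale \<beta> (fscale c u) = scale c (extend scale \<beta> u)"
    "extend scale \<beta> (sum h I) = (\<Sum>i\<in>I. extend scale \<beta> (h i))"
    by (rule l.zero l.add l.diff l.scale l.sum)+
qed

end

section \<open>Functionals on tensors\<close>

lemma linear_extend_comp:
  assumes "Vector_Spaces.linear s s' g"
  shows "g (extend s \<beta> u) = extend s' (\<lambda>p. g (\<beta> p)) u"
proof -
  interpret Vector_Spaces.linear s s' g by fact
  show ?thesis by (simp add: extend_def sum scale)
qed

lemma extend_mult_left:
  "extend (*) (\<lambda>p. c * \<beta> p) u = c * extend (*) \<beta> (u :: 'x \<Rightarrow>\<^sub>0 'k::field)"
  by (simp add: extend_def sum_distrib_left mult.left_commute)

text \<open>The bilinear form built from \<open>f\<close> and \<open>g\<close> kills each generating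
  relation, so it descends from formal sums to the tensor product.\<close>

lemma extend_tensor_null:
  assumes "Vector_Spaces.linear s (*) f" "Vector_Spaces.linear s (*) g" "u \<in> tensor2_null s"
  shows "extend (*) (\<lambda>(a, b). f a * g b) u = 0"
proof -
  interpret f: Vector_Spaces.linear s "(*)" f by fact
  interpret g: Vector_Spaces.linear s "(*)" g by fact
  show ?thesis using assms(3) unfolding tensor2_null_def
  proof (induction rule: fscale.span_induct_alt)
    case (step c x y)
    from step.hyps have "extend (*) (\<lambda>(a, b). f a * g b) x = 0"
      by (elim UnE CollectE exE conjE)
        (simp_all add: field_mult.extend_diff field_mult.extend_fscale f.add g.add f.scale g.scale
          distrib_left distrib_right mult.left_commute)
    then show ?case using step by (simp add: field_mult.extend_add field_mult.extend_fscale)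
  qed simp
qed

lemma extend_tensor_cong:
  assumes "Vector_Spaces.linear s (*) f" "Vector_Spaces.linear s (*) g" "tensor2_eq s u v"
  shows "extend (*) (\<lambda>(a, b). f a * g b) u = extend (*) (\<lambda>(a, b). f a * g b) v"
  using extend_tensor_null[OF assms(1,2), of "u - v"] assms(3)
  by (simp add: tensor2_eq_def field_mult.extend_diff)

text \<open>Maps into formal sums such as \<open>a \<mapsto> a \<otimes> b\<close> are linear only
  modulo the bilinear relations. This carries such weak linearity over to finite linear
  combinations.\<close>

lemma linear_mod_expand:
  fixes s :: "'k::field \<Rightarrow> 'a::ab_group_add \<Rightarrow> 'a" and f :: "'a \<Rightarrow> ('x \<Rightarrow>\<^sub>0 'k)"
  assumes "vector_space s" and N: "fscale.subspace N"
    and add: "\<And>a b. f (a + b) - f a - f b \<in> N"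
    and scale: "\<And>c a. f (s c a) - fscale c (f a) \<in> N"
    and "finite I"
  shows "f (\<Sum>i\<in>I. s (c i) (e i)) - (\<Sum>i\<in>I. fscale (c i) (f (e i))) \<in> N"
  using \<open>finite I\<close>
proof induction
  case empty
  interpret vector_space s by fact
  \<comment> \<open>Scaling by 0 puts \<open>f 0\<close> into \<open>N\<close>, although
    \<open>f 0\<close> itself need not be 0.\<close>
  show ?case using scale[of 0 0] by simp
next
  case (insert i I)
  let ?a = "s (c i) (e i)" and ?b = "\<Sum>i\<in>I. s (c i) (e i)"
  \<comment> \<open>The defect of the longer sum telescopes into the additivity defect, the scaling
    defect and the induction hypothesis.\<close>
  have "(f (?a + ?b) - f ?a - f ?b) + (f ?a - fscale (c i) (f (e i)))
      + (f ?b - (\<Sum>i\<in>I. fscale (c i) (f (e i)))) \<in> N"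
    by (intro fscale.subspace_add[OF N] add scale insert.IH)
  then show ?case using insert.hyps by (simp add: algebra_simps)
qed

section \<open>Tensor equality tested on coordinates\<close>

lemma subspace_tensor2_null: "fscale.subspace (tensor2_null s)"
  unfolding tensor2_null_def by (rule fscale.subspace_span)

lemma tensor2_eq_refl: "tensor2_eq s u u"
  using fscale.subspace_0[OF subspace_tensor2_null] by (simp add: tensor2_eq_def)

lemma subspace_tensor3_null: "fscale.subspace (tensor3_null s)"
  unfolding tensor3_null_def by (rule fscale.subspace_span)

text \<open>Isolates what testing tensors needs: finitely many linear functionals \<open>d i\<close>
  whose values rebuild each vector from the family \<open>e\<close>.\<close>

locale coordinate_space = vector_space s
  for s :: "'k::field \<Rightarrow> 'a::ab_group_add \<Rightarrow> 'a" +
  fixes I :: "'i set" and e :: "'i \<Rightarrow> 'a" and d :: "'i \<Rightarrow> 'a \<Rightarrow> 'k"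
  assumes finite_index: "finite I"
    and linear_coordinate: "i \<in> I \<Longrightarrow> Vector_Spaces.linear s (*) (d i)"
    and expand: "(\<Sum>i\<in>I. s (d i a) (e i)) = a"
begin

lemma linear_mod_coordinates:
  fixes f :: "'a \<Rightarrow> ('x \<Rightarrow>\<^sub>0 'k)"
  assumes "fscale.subspace N"
    and "\<And>a b. f (a + b) - f a - f b \<in> N"
    and "\<And>c a. f (s c a) - fscale c (f a) \<in> N"
  shows "f a - (\<Sum>i\<in>I. fscale (d i a) (f (e i))) \<in> N"
  using linear_mod_expand[OF vector_space_axioms assms finite_index, of "\<lambda>i. d i a" e]
  by (simp add: expand)

text \<open>Modulo the relations, expand the left factor of a pure tensor and then the right one;
  induction on formal sums does the rest.\<close>

lemma tensor2_expand:
  "u - (\<Sum>i\<in>I. \<Sum>j\<in>I. fscale (extend (*) (\<lambda>(a, b). d i a * d j b) u) (e i \<otimes> e j))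
    \<in> tensor2_null s"
proof -
  let ?N = "tensor2_null s"
  note N = subspace_tensor2_null[of s]
  note N_sum = fscale.subspace_sum[OF N] and N_scale = fscale.subspace_scale[OF N]
    and N_add = fscale.subspace_add[OF N]
  have gens: "(a + a') \<otimes> b - a \<otimes> b - a' \<otimes> b \<in> ?N" "a \<otimes> (b + b') - a \<otimes> b - a \<otimes> b' \<in> ?N"
    "s c a \<otimes> b - fscale c (a \<otimes> b) \<in> ?N" "a \<otimes> s c b - fscale c (a \<otimes> b) \<in> ?N" for a a' b b' c
    unfolding tensor2_null_def by (rule fscale.span_base; blast)+
  have pure: "a \<otimes> b - (\<Sum>i\<in>I. \<Sum>j\<in>I. fscale (d i a * d j b) (e i \<otimes> e j)) \<in> ?N" for a b
  proof -
    have "(a \<otimes> b - (\<Sum>i\<in>I. fscale (d i a) (e i \<otimes> b)))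
        + (\<Sum>i\<in>I. fscale (d i a) (e i \<otimes> b - (\<Sum>j\<in>I. fscale (d j b) (e i \<otimes> e j)))) \<in> ?N"
      by (intro N_add N_sum N_scale linear_mod_coordinates[OF N] gens)
    then show ?thesis
      by (simp add: fscale.scale_right_diff_distrib sum_subtractf fscale.scale_sum_right)
  qed
  show ?thesis
  proof (induction u rule: formal_sum_induct)
    case zero
    show ?case using fscale.subspace_0[OF N] by simp
  next
    case (add u v)
    show ?case using N_add[OF add]
      by (simp add: field_mult.extend_add fscale.scale_left_distrib sum.distrib algebra_simps)
  next
    case (scale_pure c p)
    show ?case using N_scale[OF pure[of "fst p" "snd p"], of c]
      by (cases p) (simp add: field_mult.extend_fscale fscale.scale_right_diff_distrib
          fscale.scale_sum_right)
  qed
qed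

text \<open>Both tensors are congruent to the same combination of the
  \<open>e i \<otimes> e j\<close>, so a congruence modulo relations reduces to equations in the
  field.\<close>

lemma tensor2_eqI:
  assumes "\<And>i j. i \<in> I \<Longrightarrow> j \<in> I \<Longrightarrow>
    extend (*) (\<lambda>(a, b). d i a * d j b) u = extend (*) (\<lambda>(a, b). d i a * d j b) v"
  shows "tensor2_eq s u v"
  using fscale.subspace_diff[OF subspace_tensor2_null tensor2_expand[of u] tensor2_expand[of v]]
    assms by (simp add: tensor2_eq_def)

lemma tensor3_expand:
  "u - (\<Sum>i\<in>I. \<Sum>j\<in>I. \<Sum>k\<in>I.
      fscale (extend (*) (\<lambda>(a, b, c). d i a * d j b * d k c) u) (pure (e i, e j, e k)))
    \<in> tensor3_null s"
proof -
  let ?N = "tensor3_null s"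
  note N = subspace_tensor3_null[of s]
  note N_sum = fscale.subspace_sum[OF N] and N_scale = fscale.subspace_scale[OF N]
    and N_add = fscale.subspace_add[OF N]
  have gen1: "pure (a + a', b, c) - pure (a, b, c) - pure (a', b, c) \<in> ?N" for a a' b b' c c' r
    unfolding tensor3_null_def
    by (rule fscale.span_base, rule UnI1, rule UnI1, rule UnI1, rule UnI1, rule UnI1, blast)
  have gen2: "pure (a, b + b', c) - pure (a, b, c) - pure (a, b', c) \<in> ?N" for a a' b b' c c' r
    unfolding tensor3_null_def
    by (rule fscale.span_base, rule UnI1, rule UnI1, rule UnI1, rule UnI1, rule UnI2, blast)
  have gen3: "pure (a, b, c + c') - pure (a, b, c) - pure (a, b, c') \<in> ?N" for a a' b b' c c' r
    unfolding tensor3_null_def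
    by (rule fscale.span_base, rule UnI1, rule UnI1, rule UnI1, rule UnI2, blast)
  have gen4: "pure (s r a, b, c) - fscale r (pure (a, b, c)) \<in> ?N" for a a' b b' c c' r
    unfolding tensor3_null_def
    by (rule fscale.span_base, rule UnI1, rule UnI1, rule UnI2, blast)
  have gen5: "pure (a, s r b, c) - fscale r (pure (a, b, c)) \<in> ?N" for a a' b b' c c' r
    unfolding tensor3_null_def
    by (rule fscale.span_base, rule UnI1, rule UnI2, blast)
  have gen6: "pure (a, b, s r c) - fscale r (pure (a, b, c)) \<in> ?N" for a a' b b' c c' r
    unfolding tensor3_null_def
    by (rule fscale.span_base, rule UnI2, blast)
  note gens = gen1 gen2 gen3 gen4 gen5 gen6
  have pure: "pure (a, b, c) - (\<Sum>i\<in>I. \<Sum>j\<in>I. \<Sum>k\<in>I.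
      fscale (d i a * d j b * d k c) (pure (e i, e j, e k))) \<in> ?N" for a b c
  proof -
    \<comment> \<open>The three factors are expanded one after another, and the intermediate sums
      cancel.\<close>
    have "(pure (a, b, c) - (\<Sum>i\<in>I. fscale (d i a) (pure (e i, b, c))))
        + (\<Sum>i\<in>I. fscale (d i a) ((pure (e i, b, c) - (\<Sum>j\<in>I. fscale (d j b) (pure (e i, e j, c))))
          + (\<Sum>j\<in>I. fscale (d j b) (pure (e i, e j, c)
              - (\<Sum>k\<in>I. fscale (d k c) (pure (e i, e j, e k))))))) \<in> ?N"
      by (intro N_add N_sum N_scale linear_mod_coordinates[OF N] gens)
    then show ?thesis
      by (simp add: fscale.scale_right_diff_distrib sum_subtractf fscale.scale_sum_right mult.assoc)
  qed
  show ?thesis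
  proof (induction u rule: formal_sum_induct)
    case zero
    show ?case using fscale.subspace_0[OF N] by simp
  next
    case (add u v)
    show ?case using N_add[OF add]
      by (simp add: field_mult.extend_add fscale.scale_left_distrib sum.distrib algebra_simps)
  next
    case (scale_pure r p)
    show ?case using N_scale[OF pure[of "fst p" "fst (snd p)" "snd (snd p)"], of r]
      by (cases p) (simp add: field_mult.extend_fscale fscale.scale_right_diff_distrib
          fscale.scale_sum_right)
  qed
qed

lemma tensor3_eqI:
  assumes "\<And>i j k. i \<in> I \<Longrightarrow> j \<in> I \<Longrightarrow> k \<in> I \<Longrightarrow>
    extend (*) (\<lambda>(a, b, c). d i a * d j b * d k c) u =
    extend (*) (\<lambda>(a, b, c). d i a * d j b * d k c) v"
  shows "tensor3_eq s u v"
  using fscale.subspace_diff[OF subspace_tensor3_null tensor3_expand[of u] tensor3_expand[of v]]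
    assms by (simp add: tensor3_eq_def)

end

section \<open>The monomial basis\<close>

interpretation scaleA: vector_space "scaleA :: 'k::field \<Rightarrow> ('n, 'k) algA \<Rightarrow> _"
proof
  have refl: "cong_relations p p" for p :: "('n, 'k) free_algebra"
    using equivp_cong_relations by (rule equivp_reflp)
  fix a b :: 'k and x y :: "('n, 'k) algA"
  show "scaleA a (x + y) = scaleA a x + scaleA a y"
    by transfer (simp add: fscale.scale_right_distrib refl)
  show "scaleA (a + b) x = scaleA a x + scaleA b x"
    by transfer (simp add: fscale.scale_left_distrib refl)
  show "scaleA a (scaleA b x) = scaleA (a * b) x"
    by transfer (simp add: refl)
  show "scaleA 1 x = x"
    by transfer (simp add: refl)
qed

lemma scaleA_mult_left: "scaleA c (a * b) = scaleA c a * b"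
  by transfer (simp add: fscale_eq_mult mult.assoc equivp_reflp[OF equivp_cong_relations])

lemma scaleA_mult_right: "scaleA c (a * b) = a * scaleA c b"
  by (metis mult.commute scaleA_mult_left)

lemma xvar_power2: "xvar i ^ 2 = (0 :: ('n, 'k::field) algA)"
proof -
  have "xfree i ^ 2 \<in> two_sided_ideal (relations :: ('n, 'k) free_algebra set)"
    using two_sided_ideal.gen[of "xfree i ^ 2" relations 1 1] by (auto simp: relations_def)
  then have "xvar i * xvar i = (0 :: ('n, 'k) algA)"
    by transfer (simp add: cong_relations_def power2_eq_square)
  then show ?thesis by (simp add: power2_eq_square)
qed

section \<open>Exponent vectors and monomials\<close>

lemma cube_eq_PiE: "cube = Pi\<^sub>E UNIV (\<lambda>_::'n::finite. {0, 1})"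
  by (simp add: cube_def PiE_UNIV_domain Pi_def)

lemma finite_cube [simp]: "finite cube"
  by (simp add: cube_eq_PiE finite_PiE)

lemma zero_in_cube [simp]: "0 \<in> cube" and one_in_cube [simp]: "1 \<in> cube"
  by (simp_all add: cube_def)

text \<open>Distributivity: expanding the product means choosing an exponent 0 or 1 independently at
  each coordinate.\<close>

lemma sum_cube_prod:
  fixes h :: "'n::finite \<Rightarrow> nat \<Rightarrow> 'k::comm_semiring_1"
  shows "(\<Sum>v\<in>cube. \<Prod>i\<in>UNIV. h i (v i)) = (\<Prod>i\<in>UNIV. h i 0 + h i 1)"
  unfolding cube_eq_PiE by (subst prod_sum_PiE[symmetric]) simp_all

lemma xmon_add: "xmon (u + v) = xmon u * xmon v"
  by (simp add: xmon_def power_add prod.distrib)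

lemma xmon_zero: "xmon 0 = 1"
  by (simp add: xmon_def)

text \<open>Some exponent is at least 2, and \<open>xvar i ^ 2 = 0\<close>. Hence a product of basis
  monomials is a basis monomial or 0.\<close>

lemma xmon_notin_cube:
  assumes "v \<notin> cube"
  shows "xmon v = 0"
proof -
  obtain i where "v i \<noteq> 0" "v i \<noteq> 1" using assms by (auto simp: cube_def)
  then have "v i \<ge> 2" by simp
  then have "xvar i ^ v i = (0 :: ('a, 'b) algA)"
    by (metis le_add_diff_inverse mult_zero_left power_add xvar_power2)
  then show ?thesis by (auto simp: xmon_def intro!: prod_zero)
qed

text \<open>
  The coefficient of \<open>x\<^sub>v\<close> is first computed on the free algebra, where it collects all words
  with letter multiplicities \<open>v\<close>; for \<open>v\<close> in the cube it vanishes on the relations.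
\<close>

definition word_coeff :: "('n \<Rightarrow> nat) \<Rightarrow> 'n free_monoid \<Rightarrow> 'k::field" where
  "word_coeff v w = (case w of Word l \<Rightarrow> if count_list l = v then 1 else 0)"

text \<open>By bilinearity \<open>a\<close> and \<open>b\<close> may be taken to be words. A square
  makes a letter occur at least twice, which no \<open>v\<close> in the cube allows; a commutator
  gives two words with equal letter counts, which cancel.\<close>

lemma word_coeff_relation:
  fixes a b r :: "('n::finite, 'k::field) free_algebra"
  assumes "v \<in> cube" "r \<in> relations"
  shows "extend (*) (word_coeff v) (a * r * b) = 0"
proof (induction a rule: formal_sum_induct)
  case (scale_pure c p)
  show ?case
  proof (induction b rule: formal_sum_induct)
    case (scale_pure d q)
    obtain l m where lm: "p = Word l" "q = Word m" by (cases p; cases q)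
    have not: "count_list (l @ [i, i] @ m) \<noteq> v" for i
    proof
      assume "count_list (l @ [i, i] @ m) = v"
      from fun_cong[OF this, of i] assms(1) show False by (auto simp: cube_def dest: spec[of _ i])
    qed
    have swap: "count_list (l @ [i, j] @ m) = count_list (l @ [j, i] @ m)" for i j by (rule ext) simp
    from assms(2) show ?case
      unfolding relations_def
    proof (elim UnE CollectE exE conjE)
      fix i assume "r = xfree i ^ 2"
      then have "fscale c (pure p) * r * fscale d (pure q) =
          fscale (c * d) (pure (Word (l @ [i, i] @ m)))"
        by (simp add: lm xfree_def mult_single power2_eq_square flip: single_eq_fscale_pure)
      then show ?thesis using not[of i]
        by (simp add: field_mult.extend_fscale word_coeff_def)
    next
      fix i j assume "r = xfree i * xfree j - xfree j * xfree i"
      then have "fscale c (pure p) * r * fscale d (pure q) =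
          fscale (c * d) (pure (Word (l @ [i, j] @ m))) - fscale (c * d) (pure (Word (l @ [j, i] @ m)))"
        by (simp add: lm xfree_def mult_single left_diff_distrib right_diff_distrib flip: single_eq_fscale_pure)
      then show ?thesis using swap[of i j]
        by (simp add: field_mult.extend_fscale field_mult.extend_diff word_coeff_def)
    qed
  qed (simp_all add: distrib_left field_mult.extend_add)
qed (simp_all add: distrib_right field_mult.extend_add)

lemma word_coeff_ideal:
  fixes p :: "('n::finite, 'k::field) free_algebra"
  assumes "v \<in> cube" "p \<in> two_sided_ideal relations"
  shows "extend (*) (word_coeff v) p = 0"
  using assms(2) by induction (simp_all add: word_coeff_relation assms(1) field_mult.extend_add)

text \<open>For \<open>v\<close> off the cube the value is 0 by convention: there
  \<open>word_coeff v\<close> is 1 on some word containing a square, so it does not descend to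
  \<open>A\<close>.\<close>

lift_definition xcoeff :: "('n::finite \<Rightarrow> nat) \<Rightarrow> ('n, 'k::field) algA \<Rightarrow> 'k"
  is "\<lambda>v p. if v \<in> cube then extend (*) (word_coeff v) p else 0"
  using word_coeff_ideal by (fastforce simp: cong_relations_def field_mult.extend_diff)

lemma xcoeff_add: "xcoeff v (a + b) = xcoeff v a + xcoeff v b"
  by transfer (simp add: field_mult.extend_add)

lemma xcoeff_scaleA: "xcoeff v (scaleA c a) = c * xcoeff v a"
  by transfer (simp add: field_mult.extend_fscale)

lemma xcoeff_sum: "xcoeff v (sum h I) = (\<Sum>i\<in>I. xcoeff v (h i))"
proof (induction I rule: infinite_finite_induct)
  case empty
  show ?case using xcoeff_scaleA[of v 0 0] by simp
next
  case (infinite I)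
  show ?case using xcoeff_scaleA[of v 0 0] infinite by simp
qed (simp add: xcoeff_add)

text \<open>Since \<open>A\<close> is commutative, the class of a word depends only on its letter
  counts. This links monomials to the words on which \<open>xcoeff\<close> is computed.\<close>

lemma xmon_count_list:
  "xmon (count_list l) = (abs_algA (pure (Word l)) :: ('n::finite, 'k::field) algA)"
proof (induction l)
  case Nil
  have *: "count_list [] = (0 :: 'n \<Rightarrow> nat)" by (rule ext) simp
  show ?case unfolding * xmon_zero
    by (simp add: one_algA_def pure_def zero_free_monoid_def[symmetric])
next
  case (Cons i l)
  have *: "count_list (i # l) = count_list [i] + count_list l" by (rule ext) simp
  have "xmon (count_list [i]) = (\<Prod>j\<in>UNIV. if j = i then xvar i else (1 :: ('n, 'k) algA))"
    unfolding xmon_def by (rule prod.cong) auto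
  then have "xmon (count_list [i]) = (xvar i :: ('n, 'k) algA)" by simp
  moreover have "xvar i * abs_algA (pure (Word l)) = (abs_algA (pure (Word (i # l))) :: ('n, 'k) algA)"
    by (simp add: xvar_def times_algA.abs_eq xfree_def pure_def mult_single)
  ultimately show ?case unfolding * xmon_add Cons.IH by simp
qed

text \<open>On a finite type every function to \<open>nat\<close> has finite support, so it is a
  multiset and hence the letter count of a list.\<close>

lemma ex_count_list: "\<exists>l. count_list l = (v :: 'n::finite \<Rightarrow> nat)"
proof -
  obtain l where "mset l = Abs_multiset v" using ex_mset by blast
  then have "count_list l = v" by (auto simp: fun_eq_iff simp flip: count_mset)
  then show ?thesis ..
qed

text \<open>Separates the monomials before they are known to be independent; \<open>xdual\<close> is
  informative only afterwards.\<close>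

lemma xcoeff_xmon:
  assumes "v \<in> cube"
  shows "xcoeff v (xmon u) = (if u = v then 1 else 0)"
proof -
  obtain l where l: "count_list l = u" using ex_count_list by blast
  have "xcoeff v (abs_algA (pure (Word l)) :: ('a, 'b) algA) = (if u = v then 1 else 0)"
    using assms l by (simp add: xcoeff.abs_eq word_coeff_def)
  then show ?thesis by (simp add: xmon_count_list flip: l)
qed

text \<open>Words span the free algebra, and the class of a word is a basis monomial or 0.\<close>

lemma span_xmon: "scaleA.span (xmon ` cube) = (UNIV :: ('n::finite, 'k::field) algA set)"
proof -
  have "abs_algA p \<in> scaleA.span (xmon ` cube)" for p :: "('n, 'k) free_algebra"
  proof (induction p rule: formal_sum_induct)
    case zero
    show ?case using scaleA.span_zero by (simp add: zero_algA_def)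
  next
    case (add p q)
    then show ?case using scaleA.span_add by (fastforce simp flip: plus_algA.abs_eq)
  next
    case (scale_pure c w)
    obtain l where l: "w = Word l" by (cases w)
    have "abs_algA (fscale c (pure w)) = (scaleA c (xmon (count_list l)) :: ('n, 'k) algA)"
      by (simp add: xmon_count_list scaleA.abs_eq l)
    moreover have "(xmon (count_list l) :: ('n, 'k) algA) \<in> scaleA.span (xmon ` cube)"
      by (cases "count_list l \<in> cube")
        (auto simp: xmon_notin_cube intro: scaleA.span_base scaleA.span_zero)
    ultimately show ?case by (simp add: scaleA.span_scale)
  qed
  then have "a \<in> scaleA.span (xmon ` cube)" for a :: "('n, 'k) algA"
    by (induction a rule: algA.abs_induct)
  then show ?thesis by blast
qed

lemma inj_on_xmon: "inj_on (xmon :: _ \<Rightarrow> ('n::finite, 'k::field) algA) cube"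
proof (rule inj_onI)
  fix u v :: "'n \<Rightarrow> nat"
  assume "u \<in> cube" "v \<in> cube" "xmon u = (xmon v :: ('n, 'k) algA)"
  then show "u = v" using xcoeff_xmon[of v u] xcoeff_xmon[of v v]
    by (metis zero_neq_one)
qed

lemma independent_xmon:
  "scaleA.independent (xmon ` cube :: ('n::finite, 'k::field) algA set)"
proof
  assume "scaleA.dependent (xmon ` cube :: ('n, 'k) algA set)"
  then obtain c v where v: "v \<in> cube" "c (xmon v :: ('n, 'k) algA) \<noteq> 0"
    and "(\<Sum>b\<in>xmon ` cube. scaleA (c b) b) = (0 :: ('n, 'k) algA)"
    by (auto simp: scaleA.dependent_finite)
  then have "(\<Sum>u\<in>cube. scaleA (c (xmon u)) (xmon u)) = (0 :: ('n, 'k) algA)"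
    by (simp add: sum.reindex inj_on_xmon)
  \<comment> \<open>The functional \<open>xcoeff v\<close> picks the coefficient of
    \<open>xmon v\<close> out of the vanishing combination.\<close>
  then have "xcoeff v (\<Sum>u\<in>cube. scaleA (c (xmon u)) (xmon u :: ('n, 'k) algA)) = 0"
    using xcoeff_scaleA[of v 0 0] by simp
  moreover have "xcoeff v (\<Sum>u\<in>cube. scaleA (c (xmon u)) (xmon u :: ('n, 'k) algA)) =
      (\<Sum>u\<in>cube. if u = v then c (xmon u) else 0)"
    unfolding xcoeff_sum xcoeff_scaleA using v(1) by (intro sum.cong) (auto simp: xcoeff_xmon)
  ultimately show False using v by simp
qed

section \<open>The dual basis\<close>

lemma linear_xdual: "Vector_Spaces.linear scaleA (*) (xdual v)"
  unfolding xdual_def by (rule scaleA.linear_representation[OF independent_xmon span_xmon])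

lemma
  shows xdual_add: "xdual v (a + b) = xdual v a + xdual v b"
    and xdual_scaleA: "xdual v (scaleA c a) = c * xdual v a"
    and xdual_zero [simp]: "xdual v 0 = 0"
proof -
  interpret Vector_Spaces.linear scaleA "(*)" "xdual v" by (rule linear_xdual)
  show "xdual v (a + b) = xdual v a + xdual v b" "xdual v (scaleA c a) = c * xdual v a"
    "xdual v 0 = 0"
    by (rule add scale zero)+
qed

text \<open>Here \<open>u\<close> may leave the cube, so that coordinates of products of basis
  monomials can be read off as well.\<close>

lemma xdual_xmon:
  assumes "v \<in> cube"
  shows "xdual v (xmon u) = (if u = v then 1 else 0)"
proof (cases "u \<in> cube")
  case True
  then show ?thesis
    using inj_onD[OF inj_on_xmon _ assms True] unfolding xdual_def
    by (subst scaleA.representation_basis[OF independent_xmon]) auto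
qed (use assms in \<open>auto simp: xmon_notin_cube\<close>)

lemma xmon_expand: "(\<Sum>v\<in>cube. scaleA (xdual v a) (xmon v)) = a"
  using scaleA.sum_representation_eq[OF independent_xmon, of a "xmon ` cube"]
  by (simp add: span_xmon sum.reindex inj_on_xmon xdual_def)

interpretation monomials: coordinate_space scaleA "cube :: ('n::finite \<Rightarrow> nat) set"
    "xmon :: _ \<Rightarrow> ('n, 'k::field) algA" xdual
  by (intro coordinate_space.intro coordinate_space_axioms.intro scaleA.vector_space_axioms
      finite_cube linear_xdual xmon_expand)

lemma linear_eqI_xmon:
  assumes "Vector_Spaces.linear scaleA s f" "Vector_Spaces.linear scaleA s g"
    and "\<And>v. v \<in> cube \<Longrightarrow> f (xmon v) = g (xmon v)"
  shows "f a = g a"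
proof -
  interpret f: Vector_Spaces.linear scaleA s f by fact
  interpret g: Vector_Spaces.linear scaleA s g by fact
  have "f (\<Sum>v\<in>cube. scaleA (xdual v a) (xmon v)) = g (\<Sum>v\<in>cube. scaleA (xdual v a) (xmon v))"
    by (simp add: f.sum g.sum f.scale g.scale assms(3))
  then show ?thesis by (simp add: xmon_expand)
qed

lemma fin_dim_algebra_algA: "fin_dim_algebra (scaleA :: 'k::field \<Rightarrow> ('n::finite, 'k) algA \<Rightarrow> _)"
proof
  show "\<exists>B. finite B \<and> scaleA.span B = (UNIV :: ('n, 'k) algA set)"
    using span_xmon by (intro exI[of _ "xmon ` cube"]) auto
qed (rule scaleA_mult_left scaleA_mult_right)+

section \<open>Bi-Frobenius algebras with trivial antipode\<close>

text \<open>
  If the antipode formula gives the identity, then \<open>t\<close> is a dual basis for \<open>\<phi>\<close>: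
  a functional \<open>f\<close> is represented by \<open>\<Sum> f(t\<^sub>2) t\<^sub>1\<close>, and \<open>a\<close> arises from the functional
  \<open>\<phi>(_ a)\<close>. So both Frobenius conditions are automatic.
\<close>

lemma bi_frobenius_idI:
  fixes s :: "'k::field \<Rightarrow> 'a::comm_ring_1 \<Rightarrow> 'a"
  assumes "fin_dim_algebra s" "coalgebra s \<epsilon> \<Delta>"
    and hom: "algebra_hom s (*) \<epsilon>" "grouplike s \<epsilon> \<Delta> 1"
    and \<phi>: "\<phi> \<in> dual_space s"
    and cocommutative: "\<And>a. tensor2_eq s (\<Delta> a) (extend fscale (\<lambda>(a\<^sub>1, a\<^sub>2). a\<^sub>2 \<otimes> a\<^sub>1) (\<Delta> a))"
    and antipode: "\<And>a. extend s (\<lambda>(t\<^sub>1, t\<^sub>2). s (\<phi> (t\<^sub>1 * a)) t\<^sub>2) (\<Delta> t) = a"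
  shows "bi_frobenius s \<epsilon> \<Delta> \<phi> t id"
proof -
  interpret fin_dim_algebra s by fact
  interpret coalgebra s \<epsilon> \<Delta> by fact
  interpret \<phi>: Vector_Spaces.linear s "(*)" \<phi> using \<phi> by (simp add: dual_space_def)
  have mult: "Vector_Spaces.linear s s (\<lambda>x. x * a)" "Vector_Spaces.linear s s (\<lambda>x. a * x)" for a
    by unfold_locales (auto simp: distrib_left distrib_right scale_mult_left,
        metis scale_mult_right scale_mult_left)
  have dual: "(\<lambda>x. \<phi> (x * a)) \<in> dual_space s" for a
    using Vector_Spaces.linear_compose[OF mult(1) \<phi>.linear_axioms]
    by (simp add: dual_space_def comp_def)
  show ?thesis
  proof
    show "frobenius_algebra s \<phi>"
      unfolding frobenius_algebra_def
    proof (intro conjI \<phi> equalityI subsetI)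
      fix f assume "f \<in> dual_space s"
      then have f: "Vector_Spaces.linear s (*) f" by (simp add: dual_space_def)
      interpret f: Vector_Spaces.linear s "(*)" f by fact
      define a where "a = extend s (\<lambda>(t\<^sub>1, t\<^sub>2). s (f t\<^sub>2) t\<^sub>1) (\<Delta> t)"
      have "\<phi> (x * a) = f x" for x
      proof -
        \<comment> \<open>Commutativity turns \<open>\<phi> (x * t\<^sub>1)\<close> into
          \<open>\<phi> (t\<^sub>1 * x)\<close>, the form in which the antipode formula returns
          \<open>x\<close>.\<close>
        have "\<phi> (x * a) = extend (*) (\<lambda>(t\<^sub>1, t\<^sub>2). \<phi> (t\<^sub>1 * x) * f t\<^sub>2) (\<Delta> t)"
          unfolding a_def
          by (simp add: linear_extend_comp[OF mult(2)] linear_extend_comp[OF \<phi>.linear_axioms]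
              case_prod_beta' mult.commute \<phi>.scale flip: scale_mult_right)
        also have "\<dots> = f (extend s (\<lambda>(t\<^sub>1, t\<^sub>2). s (\<phi> (t\<^sub>1 * x)) t\<^sub>2) (\<Delta> t))"
          by (simp add: linear_extend_comp[OF f] case_prod_beta' f.scale)
        finally show ?thesis by (simp add: antipode)
      qed
      then have "f = (\<lambda>x. \<phi> (x * a))" by (simp add: fun_eq_iff)
      then show "f \<in> range (\<lambda>a x. \<phi> (x * a))" by (rule range_eqI)
    qed (use dual in auto)
    show "frobenius_coalgebra s \<Delta> t"
      unfolding frobenius_coalgebra_def 
    proof (rule UNIV_eq_I)
      fix a
      show "a \<in> (\<lambda>f. extend s (\<lambda>(t\<^sub>1, t\<^sub>2). s (f t\<^sub>1) t\<^sub>2) (\<Delta> t)) ` dual_space s"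
        by (rule image_eqI[OF _ dual[of a]]) (simp add: antipode)
    qed
    show "id a = extend s (\<lambda>(t\<^sub>1, t\<^sub>2). s (\<phi> (t\<^sub>1 * a)) t\<^sub>2) (\<Delta> t)" for a
      by (simp add: antipode)
    show "algebra_antihom s s id"
      by (simp add: algebra_antihom_def linear_id mult.commute)
    show "coalgebra_antihom s \<epsilon> \<Delta> s \<epsilon> \<Delta> id"
      by (simp add: coalgebra_antihom_def linear_id cocommutative)
  qed (rule hom)+
qed

section \<open>Comultiplications given by products over the coordinates\<close>

lemma linear_from_basis_linear:
  assumes "vector_space s"
  shows "Vector_Spaces.linear scaleA s (linear_from_basis s F)"
proof -
  interpret vector_space s by fact
  show ?thesis
    by unfold_locales (simp_all add: linear_from_basis_def xdual_add xdual_scaleA scale_left_distrib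
        sum.distrib scale_sum_right)
qed

lemma linear_from_basis_xmon:
  assumes "vector_space s" "v \<in> cube"
  shows "linear_from_basis s F (xmon v) = F v"
proof -
  interpret vector_space s by fact
  have "linear_from_basis s F (xmon v) = (\<Sum>u\<in>cube. if u = v then F u else 0)"
    unfolding linear_from_basis_def by (rule sum.cong) (auto simp: xdual_xmon)
  then show ?thesis using assms(2) by simp
qed

lemma epsA_eq_xdual: "epsA a = xdual 0 a"
proof -
  have "epsA a = (\<Sum>v\<in>cube. if v = 0 then xdual v a else 0)"
    unfolding epsA_def linear_from_basis_def by (rule sum.cong) auto
  then show ?thesis by simp
qed

lemma linear_mult_algA:
  assumes "Vector_Spaces.linear scaleA s f"
  shows "Vector_Spaces.linear scaleA s (\<lambda>a. f (a * b))" "Vector_Spaces.linear scaleA s (\<lambda>a. f (b * a))"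
proof -
  have "Vector_Spaces.linear scaleA scaleA (\<lambda>a. a * b)"
    by unfold_locales (simp_all add: distrib_right scaleA_mult_left)
  from Vector_Spaces.linear_compose[OF this assms]
  show "Vector_Spaces.linear scaleA s (\<lambda>a. f (a * b))" by (simp add: comp_def)
  then show "Vector_Spaces.linear scaleA s (\<lambda>a. f (b * a))" by (simp add: mult.commute)
qed

lemma epsA_hom: "algebra_hom scaleA (*) (epsA :: ('n::finite, 'k::field) algA \<Rightarrow> 'k)"
proof -
  let ?\<epsilon> = "xdual 0 :: ('n, 'k) algA \<Rightarrow> 'k"
  have lin: "Vector_Spaces.linear scaleA (*) (\<lambda>a. ?\<epsilon> a * c)"
    "Vector_Spaces.linear scaleA (*) (\<lambda>a. c * ?\<epsilon> a)" for c
    by unfold_locales (simp_all add: xdual_add xdual_scaleA algebra_simps)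
  \<comment> \<open>For natural exponents \<open>u + v = 0\<close> forces \<open>u = 0\<close> and
    \<open>v = 0\<close>. Linearity then extends multiplicativity one argument at a time.\<close>
  have basis: "?\<epsilon> (xmon u * xmon v) = ?\<epsilon> (xmon u) * ?\<epsilon> (xmon v)" for u v
    by (auto simp: xdual_xmon fun_eq_iff simp flip: xmon_add)
  have "?\<epsilon> (xmon u * b) = ?\<epsilon> (xmon u) * ?\<epsilon> b" for u b
    by (rule linear_eqI_xmon[OF linear_mult_algA(2)[OF linear_xdual] lin(2)]) (rule basis)
  then have "?\<epsilon> (a * b) = ?\<epsilon> a * ?\<epsilon> b" for a b
    by (rule linear_eqI_xmon[OF linear_mult_algA(1)[OF linear_xdual] lin(1)])
  moreover have "?\<epsilon> 1 = 1"
    using xdual_xmon[of 0 "0 :: 'n \<Rightarrow> nat"] by (simp add: xmon_zero)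
  ultimately show ?thesis
    using linear_xdual by (simp add: algebra_hom_def epsA_eq_xdual[abs_def])
qed

lemma linear_epsA: "Vector_Spaces.linear scaleA (*) epsA"
  and epsA_one: "epsA 1 = 1"
  using epsA_hom by (auto simp: algebra_hom_def)

lemma sum_mult_xdual:
  assumes "j \<in> cube"
  shows "(\<Sum>q\<in>cube. h q * (xdual j (xmon q :: ('n::finite, 'k::field) algA) * g q)) = h j * g j"
proof -
  have "(\<Sum>q\<in>cube. h q * (xdual j (xmon q :: ('n, 'k) algA) * g q)) =
      (\<Sum>q\<in>cube. if q = j then h q * g q else 0)"
    using assms by (intro sum.cong) (auto simp: xdual_xmon)
  then show ?thesis using assms by simp
qed

lemma sum_xdual_mult:
  assumes "p \<in> cube"
  shows "(\<Sum>v\<in>cube. xdual v (xmon p :: ('n::finite, 'k::field) algA) * h v) = h p"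
proof -
  have "(\<Sum>v\<in>cube. xdual v (xmon p :: ('n, 'k) algA) * h v) = (\<Sum>v\<in>cube. if v = p then h v else 0)"
    by (rule sum.cong) (auto simp: xdual_xmon)
  then show ?thesis using assms by simp
qed

text \<open>One zero factor kills the product, so conditions at each coordinate merge into one
  condition on exponent vectors.\<close>

lemma prod_if_zero:
  fixes g :: "'n::finite \<Rightarrow> 'k::field"
  shows "(\<Prod>i\<in>UNIV. if P i then g i else 0) = (if \<forall>i. P i then \<Prod>i\<in>UNIV. g i else 0)"
  by (auto intro: prod_zero)

text \<open>In \<open>k[x]/(x^2)\<close>, \<open>d u p q\<close> is the coefficient of
  \<open>x^p \<otimes> x^q\<close> in the coproduct of \<open>x^u\<close>, and \<open>f w\<close> is
  the value of \<phi> at \<open>x^w\<close>. The last axiom is the antipode formula for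
  \<open>t = x\<close> with the identity as antipode; it forces \<open>f 1 = 1\<close>,
  \<open>f 2 = 0\<close> and \<open>f 0 = - d 1 1 1\<close>.\<close>

locale coordinatewise =
  fixes d :: "nat \<Rightarrow> nat \<Rightarrow> nat \<Rightarrow> 'k::field" and f :: "nat \<Rightarrow> 'k"
  assumes unit: "p \<in> {0, 1} \<Longrightarrow> q \<in> {0, 1} \<Longrightarrow> d 0 p q = (if p = 0 \<and> q = 0 then 1 else 0)"
    and sym: "u \<in> {0, 1} \<Longrightarrow> p \<in> {0, 1} \<Longrightarrow> q \<in> {0, 1} \<Longrightarrow> d u p q = d u q p"
    and counit: "u \<in> {0, 1} \<Longrightarrow> q \<in> {0, 1} \<Longrightarrow> d u 0 q = (if q = u then 1 else 0)"
    and coassoc: "u \<in> {0, 1} \<Longrightarrow> p \<in> {0, 1} \<Longrightarrow> q \<in> {0, 1} \<Longrightarrow> r \<in> {0, 1} \<Longrightarrow>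
      d u 0 r * d 0 p q + d u 1 r * d 1 p q = d u p 0 * d 0 q r + d u p 1 * d 1 q r"
    and antipode: "a \<in> {0, 1} \<Longrightarrow> q \<in> {0, 1} \<Longrightarrow>
      d 1 0 q * f a + d 1 1 q * f (1 + a) = (if q = a then 1 else 0)"
begin

section \<open>Structure constants over the cube\<close>

definition D :: "('n::finite \<Rightarrow> nat) \<Rightarrow> ('n \<Rightarrow> nat) \<Rightarrow> ('n \<Rightarrow> nat) \<Rightarrow> 'k" where
  "D v p q = (\<Prod>i\<in>UNIV. d (v i) (p i) (q i))"

definition comult :: "('n::finite, 'k) algA \<Rightarrow> (('n, 'k) algA \<times> ('n, 'k) algA \<Rightarrow>\<^sub>0 'k)" where
  "comult = linear_from_basis fscale
    (\<lambda>v. \<Sum>p\<in>cube. \<Sum>q\<in>cube. fscale (D v p q) (xmon p \<otimes> xmon q))"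

lemma linear_comult: "Vector_Spaces.linear scaleA fscale comult"
  unfolding comult_def by (rule linear_from_basis_linear) unfold_locales

lemma extend_comult:
  assumes "vector_space s"
  shows "extend s \<beta> (comult a) = (\<Sum>v\<in>cube. s (xdual v a)
    (\<Sum>p\<in>cube. \<Sum>q\<in>cube. s (D v p q) (\<beta> (xmon p, xmon q))))"
proof -
  interpret vector_space s by fact
  show ?thesis
    by (simp add: comult_def linear_from_basis_def extend_sum extend_fscale)
qed

lemma D_zero: "p \<in> cube \<Longrightarrow> q \<in> cube \<Longrightarrow> D 0 p q = (if p = 0 \<and> q = 0 then 1 else 0)"
  unfolding D_def by (auto simp: cube_def unit prod_if_zero fun_eq_iff)

lemma D_sym: "v \<in> cube \<Longrightarrow> p \<in> cube \<Longrightarrow> q \<in> cube \<Longrightarrow> D v p q = D v q p"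
  unfolding D_def by (intro prod.cong refl sym) (auto simp: cube_def)

lemma D_counit: "v \<in> cube \<Longrightarrow> q \<in> cube \<Longrightarrow> D v 0 q = (if q = v then 1 else 0)"
  unfolding D_def by (simp add: cube_def counit prod_if_zero fun_eq_iff)

lemma D_coassoc:
  assumes "v \<in> cube" "p \<in> cube" "q \<in> cube" "r \<in> cube"
  shows "(\<Sum>w\<in>cube. D v w r * D w p q) = (\<Sum>w\<in>cube. D v p w * D w q r)"
proof -
  have "(\<Sum>w\<in>cube. D v w r * D w p q) =
      (\<Prod>i\<in>UNIV. d (v i) 0 (r i) * d 0 (p i) (q i) + d (v i) 1 (r i) * d 1 (p i) (q i))"
    unfolding D_def prod.distrib[symmetric]
    by (rule sum_cube_prod[where h = "\<lambda>i b. d (v i) b (r i) * d b (p i) (q i)"])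
  also have "\<dots> = (\<Prod>i\<in>UNIV. d (v i) (p i) 0 * d 0 (q i) (r i) + d (v i) (p i) 1 * d 1 (q i) (r i))"
    using assms by (intro prod.cong refl coassoc) (auto simp: cube_def)
  also have "\<dots> = (\<Sum>w\<in>cube. D v p w * D w q r)"
    unfolding D_def prod.distrib[symmetric]
    by (rule sum_cube_prod[where h = "\<lambda>i b. d (v i) (p i) b * d b (q i) (r i)", symmetric])
  finally show ?thesis .
qed

text \<open>This is the coefficient of \<open>xmon q\<close> in the antipode formula at
  \<open>xmon a\<close> with \<open>t = xmon 1\<close>: the product over \<open>f\<close> is \<phi>
  of \<open>xmon p * xmon a\<close>.\<close>

lemma D_antipode:
  assumes "a \<in> cube" "q \<in> cube"
  shows "(\<Sum>p\<in>cube. D 1 p q * (\<Prod>i\<in>UNIV. f (p i + a i))) = (if q = a then 1 else 0)"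
proof -
  have "(\<Sum>p\<in>cube. D 1 p q * (\<Prod>i\<in>UNIV. f (p i + a i))) =
      (\<Prod>i\<in>UNIV. d 1 0 (q i) * f (a i) + d 1 1 (q i) * f (1 + a i))"
    unfolding D_def prod.distrib[symmetric]
    using sum_cube_prod[where h = "\<lambda>i b. d 1 b (q i) * f (b + a i)"] by simp
  also have "\<dots> = (\<Prod>i\<in>UNIV. if q i = a i then 1 else 0)"
    using assms by (intro prod.cong refl antipode) (auto simp: cube_def)
  finally show ?thesis by (simp add: prod_if_zero fun_eq_iff)
qed

lemma coeff_comult:
  assumes "i \<in> cube" "j \<in> cube"
  shows "extend (*) (\<lambda>(a, b). xdual i a * xdual j b) (comult (a :: ('n::finite, 'k) algA)) =
    (\<Sum>v\<in>cube. xdual v a * D v i j)"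
proof -
  have "(\<Sum>p\<in>cube. \<Sum>q\<in>cube. D v p q *
      (xdual i (xmon p :: ('n::finite, 'k) algA) * xdual j (xmon q :: ('n, 'k) algA))) = D v i j" for v
  proof -
    have "(\<Sum>q\<in>cube. D v p q *
        (xdual i (xmon p :: ('n::finite, 'k) algA) * xdual j (xmon q :: ('n, 'k) algA))) =
        D v p j * (xdual i (xmon p :: ('n::finite, 'k) algA) * 1)" for p
      using sum_mult_xdual[OF assms(2), of "D v p" "\<lambda>_. xdual i (xmon p :: ('n, 'k) algA)"]
      by (simp add: mult.commute)
    then have "(\<Sum>p\<in>cube. \<Sum>q\<in>cube. D v p q *
        (xdual i (xmon p :: ('n::finite, 'k) algA) * xdual j (xmon q :: ('n, 'k) algA))) =
        (\<Sum>p\<in>cube. D v p j * (xdual i (xmon p :: ('n::finite, 'k) algA) * 1))"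
      by (rule sum.cong[OF refl])
    then show ?thesis using sum_mult_xdual[OF assms(1), of "\<lambda>p. D v p j" "\<lambda>_. 1"] by simp
  qed
  then show ?thesis
    by (simp add: extend_comult[OF field_mult.vector_space_axioms])
qed

lemma comult_coassociative:
  "tensor3_eq scaleA
    (extend fscale (\<lambda>(a\<^sub>1, a\<^sub>2). extend fscale (\<lambda>(b\<^sub>1, b\<^sub>2). pure (b\<^sub>1, b\<^sub>2, a\<^sub>2)) (comult a\<^sub>1)) (comult a))
    (extend fscale (\<lambda>(a\<^sub>1, a\<^sub>2). extend fscale (\<lambda>(b\<^sub>1, b\<^sub>2). pure (a\<^sub>1, b\<^sub>1, b\<^sub>2)) (comult a\<^sub>2)) (comult a))"
  (is "tensor3_eq _ ?L ?R")
proof (rule monomials.tensor3_eqI)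
  fix i j k :: "'a \<Rightarrow> nat"
  assume ijk: "i \<in> cube" "j \<in> cube" "k \<in> cube"
  let ?\<tau> = "\<lambda>(a :: ('a, 'k) algA, b, c). xdual i a * xdual j b * xdual k c"
  note comp = linear_extend_comp[OF field_mult.linear_extend]
  \<comment> \<open>\<open>coeff_comult\<close> evaluates the inner coproduct, while the outer
    factor keeps its own coordinate.\<close>
  have left: "extend (*) ?\<tau> (extend fscale (\<lambda>(b\<^sub>1, b\<^sub>2). pure (b\<^sub>1, b\<^sub>2, a\<^sub>2)) (comult a\<^sub>1)) =
      xdual k a\<^sub>2 * (\<Sum>v\<in>cube. xdual v a\<^sub>1 * D v i j)" for a\<^sub>1 a\<^sub>2
    unfolding comp coeff_comult[OF ijk(1,2), symmetric] extend_mult_left[symmetric]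
    by (simp add: case_prod_beta' mult.commute)
  have right: "extend (*) ?\<tau> (extend fscale (\<lambda>(b\<^sub>1, b\<^sub>2). pure (a\<^sub>1, b\<^sub>1, b\<^sub>2)) (comult a\<^sub>2)) =
      xdual i a\<^sub>1 * (\<Sum>v\<in>cube. xdual v a\<^sub>2 * D v j k)" for a\<^sub>1 a\<^sub>2
    unfolding comp coeff_comult[OF ijk(2,3), symmetric] extend_mult_left[symmetric]
    by (simp add: case_prod_beta' mult.assoc)
  \<comment> \<open>On this side the Kronecker delta sits on \<open>p\<close>, so the sums are
    exchanged before the contraction.\<close>
  have swap: "(\<Sum>w\<in>cube. D v i w * D w j k) =
      (\<Sum>p\<in>cube. \<Sum>q\<in>cube. D v p q * (xdual i (xmon p :: ('a, 'k) algA) * D q j k))" for v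
    by (subst sum.swap) (simp add: sum_mult_xdual ijk)
  have "extend (*) ?\<tau> ?L =
      (\<Sum>v\<in>cube. xdual v a * (\<Sum>p\<in>cube. \<Sum>q\<in>cube. D v p q * (xdual k (xmon q :: ('a, 'k) algA) * D p i j)))"
    unfolding comp
    by (simp add: case_prod_beta' left[unfolded case_prod_beta'] extend_comult[OF field_mult.vector_space_axioms]
        sum_xdual_mult)
  also have "\<dots> = (\<Sum>v\<in>cube. xdual v a * (\<Sum>w\<in>cube. D v w k * D w i j))"
    using ijk by (simp add: sum_mult_xdual)
  also have "\<dots> = (\<Sum>v\<in>cube. xdual v a * (\<Sum>w\<in>cube. D v i w * D w j k))"
    using ijk by (simp add: D_coassoc)
  also have "\<dots> = (\<Sum>v\<in>cube. xdual v a * (\<Sum>p\<in>cube. \<Sum>q\<in>cube.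
      D v p q * (xdual i (xmon p :: ('a, 'k) algA) * D q j k)))"
    unfolding swap ..
  also have "\<dots> = extend (*) ?\<tau> ?R"
    unfolding comp
    by (simp add: case_prod_beta' right[unfolded case_prod_beta' prod.collapse] extend_comult[OF field_mult.vector_space_axioms]
        sum_xdual_mult)
  finally show "extend (*) ?\<tau> ?L = extend (*) ?\<tau> ?R" .
qed

lemma comult_cocommutative:
  "tensor2_eq scaleA (comult a) (extend fscale (\<lambda>(a\<^sub>1, a\<^sub>2). a\<^sub>2 \<otimes> a\<^sub>1) (comult a))"
proof (rule monomials.tensor2_eqI)
  fix i j :: "'a \<Rightarrow> nat"
  assume ij: "i \<in> cube" "j \<in> cube"
  have "extend (*) (\<lambda>(a, b). xdual i a * xdual j b) (extend fscale (\<lambda>(a\<^sub>1, a\<^sub>2). a\<^sub>2 \<otimes> a\<^sub>1) (comult a))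
      = extend (*) (\<lambda>(a, b). xdual j a * xdual i b) (comult a)"
    unfolding linear_extend_comp[OF field_mult.linear_extend]
    by (simp add: case_prod_beta' mult.commute)
  then show "extend (*) (\<lambda>(a, b). xdual i a * xdual j b) (comult a) =
      extend (*) (\<lambda>(a, b). xdual i a * xdual j b) (extend fscale (\<lambda>(a\<^sub>1, a\<^sub>2). a\<^sub>2 \<otimes> a\<^sub>1) (comult a))"
    using ij by (simp add: coeff_comult D_sym)
qed

lemma coalgebra_comult: "coalgebra scaleA epsA (comult :: ('n::finite, 'k) algA \<Rightarrow> _)"
proof -
  interpret comult: Vector_Spaces.linear scaleA fscale "comult :: ('n, 'k) algA \<Rightarrow> _"
    by (rule linear_comult)
  show ?thesis
  proof (intro coalgebra.intro coalgebra_axioms.intro)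
    fix a b :: "('n, 'k) algA" and c :: 'k
    show "Vector_Spaces.linear scaleA (*) (epsA :: ('n, 'k) algA \<Rightarrow> 'k)"
      by (rule linear_epsA)
    show "tensor2_eq scaleA (comult (a + b)) (comult a + comult b)"
      "tensor2_eq scaleA (comult (scaleA c a)) (fscale c (comult a))"
      by (simp_all add: comult.add comult.scale tensor2_eq_refl)
    \<comment> \<open>The counit keeps only \<open>p = 0\<close>, and there \<open>D_counit\<close>
      leaves the single term \<open>q = v\<close>.\<close>
    have sum_D: "(\<Sum>q\<in>cube. scaleA (D v 0 q) (xmon q)) = (xmon v :: ('n, 'k) algA)" if "v \<in> cube" for v
    proof -
      have "(\<Sum>q\<in>cube. scaleA (D v 0 q) (xmon q :: ('n, 'k) algA)) =
          (\<Sum>q\<in>cube. if q = v then xmon q else 0)"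
        using that by (intro sum.cong) (auto simp: D_counit)
      then show ?thesis using that by simp
    qed
    have "(\<Sum>p\<in>cube. \<Sum>q\<in>cube. scaleA (D v p q) (scaleA (epsA (xmon p :: ('n, 'k) algA)) (xmon q)))
        = (xmon v :: ('n, 'k) algA)" if "v \<in> cube" for v
    proof -
      have "(\<Sum>q\<in>cube. scaleA (D v p q) (scaleA (epsA (xmon p :: ('n, 'k) algA)) (xmon q))) =
          (if p = 0 then xmon v else (0 :: ('n, 'k) algA))" for p
        using sum_D[OF that] by (simp add: epsA_eq_xdual xdual_xmon)
      then show ?thesis by simp
    qed
    then show "extend scaleA (\<lambda>(a\<^sub>1, a\<^sub>2). scaleA (epsA a\<^sub>1) a\<^sub>2) (comult a) = a"
      by (simp add: extend_comult[OF scaleA.vector_space_axioms] xmon_expand)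
    \<comment> \<open>By \<open>D_sym\<close> the right counit law becomes the left one after the
      sums are exchanged.\<close>
    have "(\<Sum>p\<in>cube. \<Sum>q\<in>cube. scaleA (D v p q) (scaleA (epsA (xmon q :: ('n, 'k) algA)) (xmon p)))
        = (xmon v :: ('n, 'k) algA)" if "v \<in> cube" for v
    proof -
      have "(\<Sum>p\<in>cube. scaleA (D v p q) (scaleA (epsA (xmon q :: ('n, 'k) algA)) (xmon p))) =
          (if q = 0 then \<Sum>p\<in>cube. scaleA (D v 0 p) (xmon p) else (0 :: ('n, 'k) algA))" for q
        using that by (simp add: epsA_eq_xdual xdual_xmon D_sym[of v _ 0] cong: sum.cong)
      then show ?thesis by (subst sum.swap) (simp add: sum_D that)
    qed
    then show "extend scaleA (\<lambda>(a\<^sub>1, a\<^sub>2). scaleA (epsA a\<^sub>2) a\<^sub>1) (comult a) = a"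
      by (simp add: extend_comult[OF scaleA.vector_space_axioms] xmon_expand)
  qed (rule comult_coassociative scaleA.vector_space_axioms)+
qed

lemma grouplike_one: "grouplike scaleA epsA comult (1 :: ('n::finite, 'k) algA)"
proof -
  have "tensor2_eq scaleA (comult (xmon 0)) (xmon 0 \<otimes> (xmon 0 :: ('n, 'k) algA))"
  proof (rule monomials.tensor2_eqI)
    fix i j :: "'n \<Rightarrow> nat"
    assume "i \<in> cube" "j \<in> cube"
    then show "extend (*) (\<lambda>(a, b). xdual i a * xdual j b) (comult (xmon 0)) =
        extend (*) (\<lambda>(a, b). xdual i a * xdual j b) (xmon 0 \<otimes> (xmon 0 :: ('n, 'k) algA))"
      unfolding coeff_comult[OF \<open>i \<in> cube\<close> \<open>j \<in> cube\<close>] sum_xdual_mult[OF zero_in_cube]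
      by (auto simp: xdual_xmon D_zero)
  qed
  then show ?thesis by (simp add: grouplike_def xmon_zero epsA_one)
qed

text \<open>The condition on \<open>\<phi>\<close> covers exponents beyond the cube because \<phi>
  is evaluated at \<open>xmon (p + a)\<close>, where entries may equal 2.\<close>

lemma bi_frobenius_comult:
  fixes \<phi> :: "('n::finite, 'k) algA \<Rightarrow> 'k"
  assumes "Vector_Spaces.linear scaleA (*) \<phi>" and \<phi>: "\<And>w. \<phi> (xmon w) = (\<Prod>i\<in>UNIV. f (w i))"
  shows "bi_frobenius scaleA epsA comult \<phi> (xmon 1) id"
proof (rule bi_frobenius_idI)
  interpret \<phi>: Vector_Spaces.linear scaleA "(*)" \<phi> by fact
  show "\<phi> \<in> dual_space scaleA" using assms(1) by (simp add: dual_space_def)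
  show "extend scaleA (\<lambda>(t\<^sub>1, t\<^sub>2). scaleA (\<phi> (t\<^sub>1 * a)) t\<^sub>2) (comult (xmon 1)) = a" for a
  proof (rule linear_eqI_xmon)
    show "Vector_Spaces.linear scaleA scaleA
        (\<lambda>a. extend scaleA (\<lambda>(t\<^sub>1, t\<^sub>2). scaleA (\<phi> (t\<^sub>1 * a)) t\<^sub>2) (comult (xmon 1)))"
      by unfold_locales (simp_all add: extend_def case_prod_beta' distrib_left \<phi>.add \<phi>.scale
          scaleA.scale_left_distrib scaleA.scale_right_distrib sum.distrib scaleA.scale_sum_right
          mult.left_commute flip: scaleA_mult_right)
    show "Vector_Spaces.linear scaleA scaleA (\<lambda>a :: ('n, 'k) algA. a)"
      by (rule scaleA.linear_ident)
    fix a :: "'n \<Rightarrow> nat" assume a: "a \<in> cube"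
    have "extend scaleA (\<lambda>(t\<^sub>1, t\<^sub>2). scaleA (\<phi> (t\<^sub>1 * xmon a)) t\<^sub>2) (comult (xmon 1)) =
        (\<Sum>v\<in>cube. if v = 1 then \<Sum>p\<in>cube. \<Sum>q\<in>cube.
          scaleA (D v p q * \<phi> (xmon (p + a))) (xmon q) else 0)"
      unfolding extend_comult[OF scaleA.vector_space_axioms]
      by (rule sum.cong) (auto simp: xdual_xmon xmon_add)
    also have "\<dots> = (\<Sum>q\<in>cube. scaleA (\<Sum>p\<in>cube. D 1 p q * (\<Prod>i\<in>UNIV. f (p i + a i))) (xmon q))"
      by (simp add: \<phi> scaleA.scale_sum_left) (rule sum.swap)
    also have "\<dots> = (\<Sum>q\<in>cube. if q = a then xmon q else 0)"
      by (rule sum.cong) (simp_all add: D_antipode a)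
    finally show "extend scaleA (\<lambda>(t\<^sub>1, t\<^sub>2). scaleA (\<phi> (t\<^sub>1 * xmon a)) t\<^sub>2) (comult (xmon 1)) = xmon a"
      using a by simp
  qed
qed (rule fin_dim_algebra_algA coalgebra_comult epsA_hom grouplike_one comult_cocommutative)+

end

section \<open>Primitive elements\<close>

text \<open>Composing coordinates of the source with \<open>inv F\<close> gives linear functionals
  on the target. They respect equality of tensors there, so they carry the primitivity equation of
  \<open>F a\<close> back to \<open>a\<close>.\<close>

lemma primitive_reflect:
  fixes s :: "'k::field \<Rightarrow> 'a::ring_1 \<Rightarrow> 'a" and s' :: "'k \<Rightarrow> 'b::ring_1 \<Rightarrow> 'b"
  assumes "coordinate_space s I e d" "bij F"
    and hom: "algebra_hom s s' F" "coalgebra_hom s \<epsilon> \<Delta> s' \<epsilon>' \<Delta>' F"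
    and prim: "primitive s' \<Delta>' (F a)"
  shows "primitive s \<Delta> a"
proof -
  interpret coordinate_space s I e d by fact
  interpret F: Vector_Spaces.linear s s' F using hom(1) by (simp add: algebra_hom_def)
  have inv_F [simp]: "inv F (F x) = x" and F_inv: "F (inv F y) = y" for x y
    using \<open>bij F\<close> by (simp_all add: bij_is_inj bij_is_surj surj_f_inv_f)
  have inv_add: "inv F (x + y) = inv F x + inv F y" for x y
    by (metis F.add F_inv inv_F)
  have inv_scale: "inv F (s' c x) = s c (inv F x)" for c x
    by (metis F.scale F_inv inv_F)
  have linear_inv: "Vector_Spaces.linear s' s (inv F)"
    by unfold_locales (rule inv_add inv_scale)+
  have inv_one: "inv F 1 = 1"
    using hom(1) by (metis algebra_hom_def inv_F)
  show ?thesis unfolding primitive_def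
  proof (rule tensor2_eqI)
    fix i j assume ij: "i \<in> I" "j \<in> I"
    note cong = extend_tensor_cong[OF
        Vector_Spaces.linear_compose[OF linear_inv linear_coordinate[OF ij(1)], unfolded comp_def]
        Vector_Spaces.linear_compose[OF linear_inv linear_coordinate[OF ij(2)], unfolded comp_def]]
    have "extend (*) (\<lambda>(a, b). d i a * d j b) (\<Delta> a) =
        extend (*) (\<lambda>(a, b). d i (inv F a) * d j (inv F b))
          (extend fscale (\<lambda>(a\<^sub>1, a\<^sub>2). F a\<^sub>1 \<otimes> F a\<^sub>2) (\<Delta> a))"
      by (simp add: linear_extend_comp[OF field_mult.linear_extend] case_prod_beta')
    also have "\<dots> = extend (*) (\<lambda>(a, b). d i (inv F a) * d j (inv F b)) (\<Delta>' (F a))"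
      using hom(2) by (intro cong[symmetric]) (simp add: coalgebra_hom_def)
    also have "\<dots> = extend (*) (\<lambda>(a, b). d i (inv F a) * d j (inv F b)) (1 \<otimes> F a + F a \<otimes> 1)"
      using prim by (intro cong) (simp add: primitive_def)
    also have "\<dots> = extend (*) (\<lambda>(a, b). d i a * d j b) (1 \<otimes> a + a \<otimes> 1)"
      by (simp add: field_mult.extend_add inv_one)
    finally show "extend (*) (\<lambda>(a, b). d i a * d j b) (\<Delta> a) =
        extend (*) (\<lambda>(a, b). d i a * d j b) (1 \<otimes> a + a \<otimes> 1)" .
  qed
qed

section \<open>The two comultiplications as coordinatewise instances\<close>

lemma sum_cube_pairs:
  fixes h :: "('n::finite \<Rightarrow> nat) \<Rightarrow> ('n \<Rightarrow> nat) \<Rightarrow> 'b::comm_monoid_add"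
  shows "(\<Sum>(p, q)\<in>{(p, q)\<in>cube \<times> cube. P p q}. h p q) =
    (\<Sum>p\<in>cube. \<Sum>q\<in>cube. if P p q then h p q else 0)"
  unfolding sum.cartesian_product
  by (rule sum.mono_neutral_cong_left) (auto split: if_splits)

text \<open>In one variable \<Delta>(x) = 1 \<otimes> x + x \<otimes> 1 - x \<otimes> x, so
  \<open>1 - x\<close> is group-like; \<phi> is 1 at both 1 and x.\<close>

interpretation overlap: coordinatewise
  "\<lambda>u p q. if p \<le> u \<and> q \<le> u \<and> u \<le> p + q then (- 1) ^ (p + q - u) else 0 :: 'k::field"
  "\<lambda>w. if w \<le> 1 then 1 else 0"
  by unfold_locales auto

text \<open>In one variable x is primitive and \<phi> reads off its coefficient.\<close>

interpretation split: coordinatewise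
  "\<lambda>u p q. if p + q = u then 1 else 0 :: 'k::field" "\<lambda>w. if w = 1 then 1 else 0"
  by unfold_locales auto

text \<open>The signs of the coordinates multiply, so their exponents add up to the weight.\<close>

lemma overlap_D:
  "overlap.D v p q =
    (if p \<le> v \<and> q \<le> v \<and> v \<le> p + q then (- 1) ^ weight (p + q - v) else 0 :: 'k::field)"
  by (auto simp: overlap.D_def prod_if_zero le_fun_def weight_def power_sum)

lemma split_D: "split.D v p q = (if p + q = v then 1 else 0 :: 'k::field)"
  by (auto simp: split.D_def prod_if_zero fun_eq_iff)

text \<open>The restricted pairs become all pairs, since \<open>overlap.D\<close> vanishes on the
  pairs outside the index set.\<close>

lemma DeltaA_eq_comult: "DeltaA = overlap.comult"
  unfolding DeltaA_def overlap.comult_def sum_cube_pairs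
  by (intro arg_cong[where f = "linear_from_basis fscale"] ext sum.cong refl) (simp add: overlap_D)

lemma Delta_div_eq_comult: "Delta_div = split.comult"
  unfolding Delta_div_def split.comult_def sum_cube_pairs
  by (intro arg_cong[where f = "linear_from_basis fscale"] ext sum.cong refl) (simp add: split_D)

lemma bi_frobenius_DeltaA:
  "bi_frobenius scaleA epsA DeltaA phiA (xmon 1) (id :: ('n::finite, 'k::field) algA \<Rightarrow> _)"
  unfolding DeltaA_eq_comult
proof (rule overlap.bi_frobenius_comult)
  show "Vector_Spaces.linear scaleA (*) (phiA :: ('n, 'k) algA \<Rightarrow> 'k)"
    by unfold_locales (simp_all add: phiA_def xdual_add xdual_scaleA sum.distrib sum_distrib_left)
  fix w :: "'n \<Rightarrow> nat"
  have "phiA (xmon w :: ('n, 'k) algA) = (\<Sum>v\<in>cube. if v = w then 1 else 0)"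
    unfolding phiA_def by (rule sum.cong) (auto simp: xdual_xmon)
  \<comment> \<open>On monomials \<open>phiA\<close> is the indicator of the cube, and membership in
    the cube is a condition on each coordinate.\<close>
  moreover have "w \<in> cube \<longleftrightarrow> (\<forall>i. w i \<le> 1)"
    by (auto simp: cube_def le_Suc_eq)
  ultimately show "phiA (xmon w :: ('n, 'k) algA) = (\<Prod>i\<in>UNIV. if w i \<le> 1 then 1 else 0)"
    by (simp add: prod_if_zero)
qed

lemma bi_frobenius_Delta_div:
  "bi_frobenius scaleA epsA Delta_div (xdual 1) (xmon 1) (id :: ('n::finite, 'k::field) algA \<Rightarrow> _)"
  unfolding Delta_div_eq_comult
  by (rule split.bi_frobenius_comult[OF linear_xdual])
    (auto simp: xdual_xmon prod_if_zero fun_eq_iff)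

text \<open>
  Compare the coefficients of \<open>x\<^sub>v \<otimes> x\<^sub>v\<close>: the only basis element whose comultiplication
  contains this tensor is \<open>x\<^sub>v\<close> itself, with coefficient \<open>\<plusminus> 1\<close>.
\<close>

lemma primitive_DeltaA:
  fixes a :: "('n::finite, 'k::field) algA"
  assumes "primitive scaleA DeltaA a"
  shows "a = 0"
proof -
  have "xdual v a = 0" if v: "v \<in> cube" for v
  proof -
    have D: "overlap.D u v v = (if u = v then (- 1) ^ weight v else 0 :: 'k)" if "u \<in> cube" for u
    proof -
      have "v \<le> u \<and> u \<le> v + v \<longleftrightarrow> u = v"
      proof
        assume le: "v \<le> u \<and> u \<le> v + v"
        show "u = v"
        proof
          fix i
          have "v i \<le> u i" "u i \<le> v i + v i" "u i \<in> {0, 1}"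
            using le that by (auto simp: le_fun_def cube_def)
          then show "u i = v i" by auto
        qed
      qed (simp add: le_fun_def)
      moreover have "v + v - v = v" by (simp add: fun_eq_iff)
      ultimately show ?thesis by (auto simp: overlap_D)
    qed
    have "xdual v a * (- 1) ^ weight v = (\<Sum>u\<in>cube. if u = v then xdual u a * (- 1) ^ weight v else 0)"
      using v by simp
    also have "\<dots> = (\<Sum>u\<in>cube. xdual u a * overlap.D u v v)"
      by (rule sum.cong) (auto simp: D)
    also have "\<dots> = extend (*) (\<lambda>(a, b). xdual v a * xdual v b) (DeltaA a)"
      by (simp add: DeltaA_eq_comult overlap.coeff_comult v)
    also have "\<dots> = extend (*) (\<lambda>(a, b). xdual v a * xdual v b) (1 \<otimes> a + a \<otimes> 1)"
      using assms by (intro extend_tensor_cong[OF linear_xdual linear_xdual]) (simp add: primitive_def)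
    also have "\<dots> = (if v = 0 then xdual v a + xdual v a else 0)"
      using xdual_xmon[OF v, of 0] by (auto simp: field_mult.extend_add xmon_zero)
    finally have "xdual v a * (- 1) ^ weight v = (if v = 0 then xdual v a + xdual v a else 0)" .
    \<comment> \<open>For \<open>v = 0\<close> the equation says that a coordinate equals its
      double, hence is 0 over any field. Otherwise the right side is 0 and the sign is
      invertible.\<close>
    moreover have "(2 :: 'k) \<noteq> 1"
      by (metis add_cancel_right_right one_add_one zero_neq_one)
    ultimately show ?thesis by (cases "v = 0") (auto simp: weight_def)
  qed
  then show ?thesis using xmon_expand[of a] by simp
qed

text \<open>The preimage of \<open>b\<close> would be a nonzero primitive element. The target is
  kept general so that both comparisons follow.\<close>

lemma not_isomorphic_DeltaA:
  fixes b :: "('n::finite, 'k::field) algA"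
  assumes "primitive s' \<Delta>' b" "b \<noteq> 0"
  shows "\<not> bi_frobenius_isomorphic scaleA epsA (DeltaA :: ('n, 'k) algA \<Rightarrow> _) S s' \<epsilon>' \<Delta>' S'"
proof
  assume "bi_frobenius_isomorphic scaleA epsA (DeltaA :: ('n, 'k) algA \<Rightarrow> _) S s' \<epsilon>' \<Delta>' S'"
  then obtain F where F: "bij F" "algebra_hom scaleA s' F"
    "coalgebra_hom scaleA epsA (DeltaA :: ('n, 'k) algA \<Rightarrow> _) s' \<epsilon>' \<Delta>' F"
    by (auto simp: bi_frobenius_isomorphic_def bi_frobenius_hom_def)
  obtain a where a: "F a = b" using F(1) by (metis bij_pointE)
  have "primitive scaleA DeltaA a"
    by (rule primitive_reflect[OF monomials.coordinate_space_axioms F]) (simp add: a assms(1))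
  then have "a = 0" by (rule primitive_DeltaA)
  interpret Vector_Spaces.linear scaleA s' F using F(2) by (simp add: algebra_hom_def)
  show False using a assms(2) zero \<open>a = 0\<close> by simp
qed

lemma primitive_xvar:
  assumes "CARD('n::finite) \<ge> 2"
  obtains b :: "('n::finite, 'k::field) algA"
  where "b \<noteq> 0" "\<And>g. primitive scaleA (Delta_g g) b" "primitive scaleA Delta_div b"
proof -
  \<comment> \<open>The second index \<open>j\<close> keeps the unit vector at \<open>i\<close>
    different from \<open>1\<close>, where \<open>Delta_g\<close> has its exceptional value.\<close>
  obtain i j :: 'n where "i \<noteq> j"
    using assms card_le_Suc0_iff_eq[of "UNIV :: 'n set"] by fastforce
  define v :: "'n \<Rightarrow> nat" where "v = (\<lambda>k. if k = i then 1 else 0)"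
  have v: "v \<in> cube" "v \<noteq> 0" "v \<noteq> 1"
    using \<open>i \<noteq> j\<close> by (auto simp: v_def cube_def fun_eq_iff)
  note xmon = linear_from_basis_xmon[OF fscale.vector_space_axioms v(1)]
  show thesis
  proof
    show "xmon v \<noteq> (0 :: ('n, 'k) algA)"
      using xdual_xmon[OF v(1), of v] by (metis xdual_zero zero_neq_one)
    show "primitive scaleA (Delta_g g) (xmon v :: ('n, 'k) algA)" for g
      using v by (simp add: primitive_def Delta_g_def xmon tensor2_eq_refl)
    \<comment> \<open>The entry 1 of a unit vector cannot be split, so it lies entirely in
      \<open>p\<close> or in \<open>q\<close>.\<close>
    have "p + q = v \<longleftrightarrow> p = 0 \<and> q = v \<or> p = v \<and> q = 0" for p q
    proof
      assume pq: "p + q = v"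
      have *: "p k + q k = (if k = i then 1 else 0)" for k
        using fun_cong[OF pq, of k] by (simp add: v_def)
      show "p = 0 \<and> q = v \<or> p = v \<and> q = 0"
      proof (cases "p i = 0")
        case True
        then have "p k = 0" for k using *[of k] by (cases "k = i") auto
        then show ?thesis using pq by (auto simp: fun_eq_iff)
      next
        case False
        then have "q k = 0" for k using *[of k] by (cases "k = i") auto
        then show ?thesis using pq by (auto simp: fun_eq_iff)
      qed
    qed auto
    then have "{(p, q) \<in> cube \<times> cube. p + q = v} = {(0, v), (v, 0)}"
      using v(1) by auto
    then have "Delta_div (xmon v) = 1 \<otimes> (xmon v :: ('n, 'k) algA) + xmon v \<otimes> 1"
      using v by (simp add: Delta_div_def xmon xmon_zero)
    then show "primitive scaleA Delta_div (xmon v :: ('n, 'k) algA)"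
      by (simp add: primitive_def tensor2_eq_refl)
  qed
qed

theorem theorem6p3:
  assumes "CARD('n::finite) \<ge> 2"
  shows "bi_frobenius scaleA epsA DeltaA phiA (\<Prod>i\<in>UNIV. xvar i) (id :: ('n, 'k::field) algA \<Rightarrow> ('n, 'k) algA)
    \<and> (\<forall>a :: ('n, 'k) algA. primitive scaleA DeltaA a \<longrightarrow> a = 0)
    \<and> (\<forall>(g :: ('n \<Rightarrow> nat) \<Rightarrow> ('n \<Rightarrow> nat) \<Rightarrow> 'k) S.
          admissible g \<longrightarrow>
          bi_frobenius scaleA epsA (Delta_g g) (xdual 1) (xmon 1) S \<longrightarrow>
          \<not> bi_frobenius_isomorphic
              scaleA epsA DeltaA (id :: ('n, 'k) algA \<Rightarrow> ('n, 'k) algA)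
              scaleA epsA (Delta_g g) S)
    \<and> bi_frobenius scaleA epsA Delta_div (xdual 1) (xmon 1) (id :: ('n, 'k) algA \<Rightarrow> ('n, 'k) algA)
    \<and> \<not> bi_frobenius_isomorphic
          scaleA epsA DeltaA (id :: ('n, 'k) algA \<Rightarrow> ('n, 'k) algA)
          scaleA epsA Delta_div (id :: ('n, 'k) algA \<Rightarrow> ('n, 'k) algA)"
proof -
  have "(\<Prod>i\<in>UNIV. xvar i) = (xmon 1 :: ('n, 'k) algA)"
    by (simp add: xmon_def)
  moreover obtain b :: "('n, 'k) algA"
    where "b \<noteq> 0" "\<And>g. primitive scaleA (Delta_g g) b" "primitive scaleA Delta_div b"
    using primitive_xvar[OF assms] by blast
  ultimately show ?thesis
    using bi_frobenius_DeltaA bi_frobenius_Delta_div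
    by (auto dest: primitive_DeltaA not_isomorphic_DeltaA)
qed

end
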